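(* Let $K$ be a field, let $I$ be a monomial ideal in the polynomial ring $K[x_1,\ldots,x_n]$, and let $u$ be a monomial which is a non-zerodivisor modulo $I$. Then (a) $C((I,u))\subseteq (C(I),u)$; (b) there exists a positive integer $k$ such that $(C(I),u^k)\subseteq C((I,u))$.
   Context: All rings are commutative with unit. For a Noetherian ring $R$ and an ideal $I=(f_1,\ldots,f_m)\subseteq R$, let $\mathcal{R}(I)=R[f_1t,\ldots,f_mt]\subseteq R[t]$ be the Rees algebra, $T=R[y_1,\ldots,y_m]$ a polynomial ring, $\varphi:T\to\mathcal{R}(I)$ the $R$-algebra homomorphism with $\varphi(y_j)=f_jt$, and $J=\ker\varphi$. Let $L\subseteq J$ be the ideal of $T$ generated by all linear relations $\sum_{i=1}^m a_iy_i$ with $a_i\in R$ and $\sum_i a_if_i=0$. Then $T/L\cong S(I)$ is the symmetric algebra of $I$, and the kernel of the canonical epimorphism $\alpha:S(I)\to\mathcal{R}(I)$ is $J/L$. The conductor of $I$ is the ideal $C(I)=L:_RJ=\{r\in R: rJ\subseteq L\}=\mathrm{Ann}_R(\ker\alpha)$ of $R$; it does not depend on the chosen generators. $(I,u)$ denotes the ideal generated by $I$ and $u$. *)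

theory Defs
  imports "HOL-Library.Poly_Mapping" "HOL-Computational_Algebra.Polynomial"
begin

text \<open>
  Ideals of a ring that is a whole type are the submodules of the ring over itself:
  \<open>ideal.subspace A\<close> says that \<open>A\<close> is an ideal, \<open>ideal.span S\<close> is the ideal generated by \<open>S\<close>.
\<close>

global_interpretation ideal: module "(*) :: 'a \<Rightarrow> 'a \<Rightarrow> 'a :: comm_ring_1"
  by unfold_locales (simp_all add: algebra_simps)

declare ideal.scale_scale [simp del] \<comment> \<open>loops with \<open>mult.assoc\<close>\<close>

text \<open>
  Polynomials in variables indexed by \<open>'v\<close> with coefficients in \<open>'r\<close>: finitely supported
  functions from exponent vectors to coefficients, with convolution as product.
\<close>

type_synonym ('v, 'r) mpol = "('v \<Rightarrow>\<^sub>0 nat) \<Rightarrow>\<^sub>0 'r"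

definition is_monomial :: "('v, 'r::zero_neq_one) mpol \<Rightarrow> bool" where
  "is_monomial p \<longleftrightarrow> (\<exists>a. p = Poly_Mapping.single a 1)"

definition monomial_ideal :: "('v, 'r::comm_ring_1) mpol set \<Rightarrow> bool" where
  "monomial_ideal I \<longleftrightarrow> (\<exists>M. (\<forall>p\<in>M. is_monomial p) \<and> I = ideal.span M)"

text \<open>Multiplication by \<open>u\<close> is injective on the residue class ring modulo \<open>I\<close>.\<close>

definition nonzerodivisor_mod :: "'r::comm_ring_1 set \<Rightarrow> 'r \<Rightarrow> bool" where
  "nonzerodivisor_mod I u \<longleftrightarrow> (\<forall>p. u * p \<in> I \<longrightarrow> p \<in> I)"

abbreviation Const :: "'r::zero \<Rightarrow> ('v, 'r) mpol" where
  "Const c \<equiv> Poly_Mapping.single 0 c"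

abbreviation Var :: "'v \<Rightarrow> ('v, 'r::zero_neq_one) mpol" where
  "Var v \<equiv> Poly_Mapping.single (Poly_Mapping.single v 1) 1"

definition mpol_eval ::
  "('r \<Rightarrow> 's) \<Rightarrow> ('v \<Rightarrow> 's) \<Rightarrow> ('v, 'r::zero) mpol \<Rightarrow> 's::comm_ring_1" where
  "mpol_eval h g p =
     (\<Sum>a\<in>Poly_Mapping.keys p.
        h (Poly_Mapping.lookup p a) * (\<Prod>v\<in>Poly_Mapping.keys a. g v ^ Poly_Mapping.lookup a v))"


text \<open>
  The ring \<open>T = R[y\<^sub>0, \<dots>, y\<^sub>m\<^sub>-\<^sub>1]\<close>. As \<open>m\<close> depends on the number of generators, it is taken as
  a subring of the polynomial ring in variables indexed by the natural numbers.
\<close>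

definition mpol_ring :: "nat \<Rightarrow> (nat, 'r::comm_ring_1) mpol set" where
  "mpol_ring m = {p. \<forall>a\<in>Poly_Mapping.keys p. Poly_Mapping.keys a \<subseteq> {..<m}}"

definition ideal_of_mpol_ring :: "nat \<Rightarrow> (nat, 'r::comm_ring_1) mpol set \<Rightarrow> bool" where
  "ideal_of_mpol_ring m A \<longleftrightarrow>
     A \<subseteq> mpol_ring m \<and> 0 \<in> A \<and> (\<forall>p\<in>A. \<forall>q\<in>A. p + q \<in> A) \<and> (\<forall>p\<in>mpol_ring m. \<forall>q\<in>A. p * q \<in> A)"

text \<open>
  For a tuple \<open>fs\<close> of generators, \<open>rees_map fs\<close> sends \<open>y\<^sub>j\<close> to \<open>f\<^sub>j t\<close>. Its values are taken in \<open>R[t]\<close>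
  instead of the subring \<open>R[f\<^sub>0 t, \<dots>, f\<^sub>m\<^sub>-\<^sub>1 t]\<close>, which does not change the kernel.
\<close>

definition rees_map :: "'r::comm_ring_1 list \<Rightarrow> (nat, 'r) mpol \<Rightarrow> 'r poly" where
  "rees_map fs = mpol_eval (\<lambda>c. [:c:]) (\<lambda>j. [:0, fs ! j:])"

definition rees_ideal :: "'r::comm_ring_1 list \<Rightarrow> (nat, 'r) mpol set" where
  "rees_ideal fs = {p \<in> mpol_ring (length fs). rees_map fs p = 0}"

definition linear_relations :: "'r::comm_ring_1 list \<Rightarrow> (nat, 'r) mpol set" where
  "linear_relations fs =
     {\<Sum>i<length fs. Const (a i) * Var i |a. (\<Sum>i<length fs. a i * fs ! i) = 0}"

definition linear_rees_ideal :: "'r::comm_ring_1 list \<Rightarrow> (nat, 'r) mpol set" where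
  "linear_rees_ideal fs = ideal_of_mpol_ring (length fs) hull linear_relations fs"

definition conductor_gens :: "'r::comm_ring_1 list \<Rightarrow> 'r set" where
  "conductor_gens fs = {r. \<forall>p\<in>rees_ideal fs. Const r * p \<in> linear_rees_ideal fs}"

text \<open>
  The conductor of a finitely generated ideal, computed with an arbitrarily chosen finite tuple of
  generators. Theorem \<open>conductor_eq\<close> below shows that the choice does not matter.
\<close>

definition conductor :: "'r::comm_ring_1 set \<Rightarrow> 'r set" where
  "conductor I = conductor_gens (SOME fs. ideal.span (set fs) = I)"


subsection \<open>Independence of the conductor from the generators\<close>

locale coeff_hom =
  fixes h :: "'r::comm_ring_1 \<Rightarrow> 's::comm_ring_1"
  assumes h0: "h 0 = 0" and h1: "h 1 = 1"
    and hadd: "h (x + y) = h x + h y" and hmult: "h (x * y) = h x * h y"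
begin

lemma hsum: "h (sum f A) = (\<Sum>x\<in>A. h (f x))"
  by (induction A rule: infinite_finite_induct) (simp_all add: h0 hadd)

lemma hprod: "h (prod f A) = (\<Prod>x\<in>A. h (f x))"
  by (induction A rule: infinite_finite_induct) (simp_all add: h1 hmult)

lemma hpow: "h (x ^ n) = h x ^ n"
  by (induction n) (simp_all add: h1 hmult)

lemma eval_superset:
  assumes "finite A" "Poly_Mapping.keys p \<subseteq> A"
  shows "mpol_eval h g p =
     (\<Sum>a\<in>A. h (Poly_Mapping.lookup p a) * (\<Prod>v\<in>Poly_Mapping.keys a. g v ^ Poly_Mapping.lookup a v))"
  unfolding mpol_eval_def using assms
  by (intro sum.mono_neutral_left) (auto simp: h0 in_keys_iff)

lemma eval_0: "mpol_eval h g 0 = 0"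
  by (simp add: mpol_eval_def)

lemma eval_add: "mpol_eval h g (p + q) = mpol_eval h g p + mpol_eval h g q"
proof -
  let ?A = "Poly_Mapping.keys p \<union> Poly_Mapping.keys q"
  have "finite ?A" by simp
  moreover have "Poly_Mapping.keys (p + q) \<subseteq> ?A" by (rule keys_add)
  ultimately show ?thesis
    using eval_superset[of ?A "p + q" g] eval_superset[of ?A p g] eval_superset[of ?A q g]
    by (simp add: lookup_add hadd distrib_right sum.distrib)
qed

lemma eval_sum: "mpol_eval h g (sum f A) = (\<Sum>x\<in>A. mpol_eval h g (f x))"
  by (induction A rule: infinite_finite_induct) (simp_all add: eval_0 eval_add)

lemma eval_single:
  "mpol_eval h g (Poly_Mapping.single a c) =
     h c * (\<Prod>v\<in>Poly_Mapping.keys a. g v ^ Poly_Mapping.lookup a v)"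
  by (cases "c = 0") (simp_all add: mpol_eval_def h0)

lemma eval_Const: "mpol_eval h g (Const c) = h c"
  by (simp add: eval_single)

lemma eval_Var: "mpol_eval h g (Var v) = g v"
  by (simp add: eval_single h1)

end

lemma monom_eval_superset:
  fixes g :: "'v \<Rightarrow> 's::comm_ring_1"
  assumes "finite A" "Poly_Mapping.keys a \<subseteq> A"
  shows "(\<Prod>v\<in>Poly_Mapping.keys a. g v ^ Poly_Mapping.lookup a v) = (\<Prod>v\<in>A. g v ^ Poly_Mapping.lookup a v)"
  using assms by (intro prod.mono_neutral_left) (auto simp: in_keys_iff)

lemma monom_eval_add:
  fixes g :: "'v \<Rightarrow> 's::comm_ring_1"
  shows "(\<Prod>v\<in>Poly_Mapping.keys (a + b). g v ^ Poly_Mapping.lookup (a + b) v) =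
    (\<Prod>v\<in>Poly_Mapping.keys a. g v ^ Poly_Mapping.lookup a v) *
    (\<Prod>v\<in>Poly_Mapping.keys b. g v ^ Poly_Mapping.lookup b v)"
proof -
  let ?A = "Poly_Mapping.keys a \<union> Poly_Mapping.keys b"
  have "finite ?A" by simp
  moreover have "Poly_Mapping.keys (a + b) \<subseteq> ?A" by (rule keys_add)
  ultimately show ?thesis
    using monom_eval_superset[of ?A "a + b" g] monom_eval_superset[of ?A a g]
      monom_eval_superset[of ?A b g]
    by (simp add: lookup_add power_add prod.distrib)
qed

lemma mpol_expand:
  "(p :: ('v, 'r::comm_ring_1) mpol) =
     (\<Sum>a\<in>Poly_Mapping.keys p. Poly_Mapping.single a (Poly_Mapping.lookup p a))"
proof (rule poly_mapping_eqI)
  fix b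
  show "Poly_Mapping.lookup p b =
    Poly_Mapping.lookup (\<Sum>a\<in>Poly_Mapping.keys p. Poly_Mapping.single a (Poly_Mapping.lookup p a)) b"
    by (simp add: lookup_sum lookup_single when_def sum.delta in_keys_iff)
qed

lemma (in coeff_hom) eval_mult: "mpol_eval h g (p * q) = mpol_eval h g p * mpol_eval h g q"
proof -
  have s: "mpol_eval h g (Poly_Mapping.single a c * Poly_Mapping.single b d) =
    mpol_eval h g (Poly_Mapping.single a c) * mpol_eval h g (Poly_Mapping.single b d)" for a b c d
    by (simp add: mult_single eval_single hmult monom_eval_add mult_ac)
  have "mpol_eval h g
      ((\<Sum>a\<in>Poly_Mapping.keys p. Poly_Mapping.single a (Poly_Mapping.lookup p a)) *
       (\<Sum>a\<in>Poly_Mapping.keys q. Poly_Mapping.single a (Poly_Mapping.lookup q a))) =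
    mpol_eval h g (\<Sum>a\<in>Poly_Mapping.keys p. Poly_Mapping.single a (Poly_Mapping.lookup p a)) *
    mpol_eval h g (\<Sum>a\<in>Poly_Mapping.keys q. Poly_Mapping.single a (Poly_Mapping.lookup q a))"
    by (simp only: sum_product eval_sum s)
  then show ?thesis
    by (simp only: mpol_expand[symmetric])
qed

lemma (in coeff_hom) coeff_hom_eval: "coeff_hom (mpol_eval h g)"
proof
  show "mpol_eval h g 1 = 1"
    using eval_Const[of g 1] by (simp add: h1)
qed (simp_all add: eval_0 eval_add eval_mult)

lemma (in coeff_hom) comp_eval:
  "h (mpol_eval k g p) = mpol_eval (\<lambda>c. h (k c)) (\<lambda>v. h (g v)) p"
  by (simp add: mpol_eval_def hsum hmult hprod hpow)

lemma coeff_hom_Const: "coeff_hom (Const :: 'r::comm_ring_1 \<Rightarrow> ('v, 'r) mpol)"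
  by unfold_locales (simp_all add: single_add mult_single)

lemma coeff_hom_poly: "coeff_hom (\<lambda>c::'r::comm_ring_1. [:c:])"
  by unfold_locales simp_all

lemma coeff_hom_rees_map: "coeff_hom (rees_map fs)"
  unfolding rees_map_def by (rule coeff_hom.coeff_hom_eval[OF coeff_hom_poly])

lemma monom_Var:
  "(\<Prod>v\<in>Poly_Mapping.keys a. (Var v :: ('v, 'r::comm_ring_1) mpol) ^ Poly_Mapping.lookup a v) =
     Poly_Mapping.single a 1"
proof -
  have pow: "(Var v :: ('v, 'r) mpol) ^ n = Poly_Mapping.single (Poly_Mapping.single v n) 1" for v n
    by (induction n) (simp_all add: mult_single single_add[symmetric])
  have "(\<Prod>v\<in>A. (Var v :: ('v, 'r) mpol) ^ Poly_Mapping.lookup a v) =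
     Poly_Mapping.single (\<Sum>v\<in>A. Poly_Mapping.single v (Poly_Mapping.lookup a v)) 1" for A
    by (induction A rule: infinite_finite_induct) (simp_all add: pow mult_single del: One_nat_def)
  moreover have "(\<Sum>v\<in>Poly_Mapping.keys a. Poly_Mapping.single v (Poly_Mapping.lookup a v)) = a"
    by (rule poly_mapping_eqI) (simp add: lookup_sum lookup_single when_def sum.delta in_keys_iff)
  ultimately show ?thesis by simp
qed

lemma eval_Const_Var: "mpol_eval Const Var p = (p :: ('v, 'r::comm_ring_1) mpol)"
  unfolding mpol_eval_def monom_Var
  by (simp add: mult_single mpol_expand[symmetric])

lemma eval_cong:
  assumes "p \<in> mpol_ring m" "\<And>i. i < m \<Longrightarrow> g i = g' i"
  shows "mpol_eval h g p = mpol_eval h g' p"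
  unfolding mpol_eval_def
proof (intro sum.cong refl arg_cong2[where f = "(*)"] prod.cong)
  fix a v assume "a \<in> Poly_Mapping.keys p" "v \<in> Poly_Mapping.keys a"
  then have "v < m" using assms(1) unfolding mpol_ring_def by auto
  then show "g v ^ Poly_Mapping.lookup a v = g' v ^ Poly_Mapping.lookup a v"
    using assms(2) by simp
qed


lemma mpol_ring_0: "0 \<in> mpol_ring m"
  by (simp add: mpol_ring_def)

lemma mpol_ring_add: "p \<in> mpol_ring m \<Longrightarrow> q \<in> mpol_ring m \<Longrightarrow> p + q \<in> mpol_ring m"
  using keys_add[of p q] unfolding mpol_ring_def by blast

lemma mpol_ring_mult:
  assumes "p \<in> mpol_ring m" "q \<in> mpol_ring m"
  shows "p * q \<in> mpol_ring m"
  unfolding mpol_ring_def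
proof safe
  fix c i assume "c \<in> Poly_Mapping.keys (p * q)" "i \<in> Poly_Mapping.keys c"
  moreover from this obtain a b
    where "c = a + b" "a \<in> Poly_Mapping.keys p" "b \<in> Poly_Mapping.keys q"
    using keys_mult[of p q] by blast
  ultimately show "i < m"
    using assms keys_add[of a b] unfolding mpol_ring_def by blast
qed

lemma mpol_ring_Const: "Const c \<in> mpol_ring m"
  by (simp add: mpol_ring_def)

lemma mpol_ring_1: "1 \<in> mpol_ring m"
  using mpol_ring_Const[of 1 m] by simp

lemma mpol_ring_Var: "i < m \<Longrightarrow> Var i \<in> mpol_ring m"
  by (simp add: mpol_ring_def)

lemma mpol_ring_sum: "(\<And>x. x \<in> A \<Longrightarrow> f x \<in> mpol_ring m) \<Longrightarrow> sum f A \<in> mpol_ring m"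
  by (induction A rule: infinite_finite_induct) (simp_all add: mpol_ring_0 mpol_ring_add)

lemma mpol_ring_prod: "(\<And>x. x \<in> A \<Longrightarrow> f x \<in> mpol_ring m) \<Longrightarrow> prod f A \<in> mpol_ring m"
  by (induction A rule: infinite_finite_induct) (simp_all add: mpol_ring_1 mpol_ring_mult)

lemma mpol_ring_pow: "p \<in> mpol_ring m \<Longrightarrow> p ^ n \<in> mpol_ring m"
  by (induction n) (simp_all add: mpol_ring_1 mpol_ring_mult)

lemma mpol_ring_eval:
  assumes "p \<in> mpol_ring l" "\<And>i. i < l \<Longrightarrow> g i \<in> mpol_ring m"
  shows "mpol_eval Const g p \<in> mpol_ring m"
  unfolding mpol_eval_def
proof (intro mpol_ring_sum mpol_ring_mult mpol_ring_Const mpol_ring_prod mpol_ring_pow)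
  fix a v assume "a \<in> Poly_Mapping.keys p" "v \<in> Poly_Mapping.keys a"
  then have "v < l" using assms(1) unfolding mpol_ring_def by auto
  then show "g v \<in> mpol_ring m" by (rule assms(2))
qed


lemma linear_relations_subset: "linear_relations fs \<subseteq> mpol_ring (length fs)"
proof
  fix p assume "p \<in> linear_relations fs"
  then obtain a where p: "p = (\<Sum>i<length fs. Const (a i) * Var i)"
    by (auto simp: linear_relations_def)
  show "p \<in> mpol_ring (length fs)"
    unfolding p by (intro mpol_ring_sum mpol_ring_mult mpol_ring_Const mpol_ring_Var) simp
qed

lemma ideal_of_mpol_ring_linear: "ideal_of_mpol_ring (length fs) (linear_rees_ideal fs)"
proof -
  have "ideal_of_mpol_ring (length fs) (mpol_ring (length fs))"
    by (simp add: ideal_of_mpol_ring_def mpol_ring_0 mpol_ring_add mpol_ring_mult)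
  then have "linear_rees_ideal fs \<subseteq> mpol_ring (length fs)"
    unfolding linear_rees_ideal_def by (intro hull_minimal linear_relations_subset)
  then show ?thesis
    unfolding linear_rees_ideal_def hull_def ideal_of_mpol_ring_def by blast
qed

lemma ideal_of_mpol_ring_sum:
  "ideal_of_mpol_ring m A \<Longrightarrow> (\<And>x. x \<in> X \<Longrightarrow> f x \<in> A) \<Longrightarrow> sum f X \<in> A"
  by (induction X rule: infinite_finite_induct) (auto simp: ideal_of_mpol_ring_def)

lemma ideal_of_mpol_ring_cong_mult:
  assumes A: "ideal_of_mpol_ring m A" and "p' \<in> mpol_ring m" "q \<in> mpol_ring m"
    and "p - p' \<in> A" "q - q' \<in> A"
  shows "p * q - p' * q' \<in> A"
proof -
  have "p * q - p' * q' = q * (p - p') + p' * (q - q')"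
    by (simp add: algebra_simps)
  then show ?thesis using assms unfolding ideal_of_mpol_ring_def by auto
qed

lemma eval_congruent:
  assumes A: "ideal_of_mpol_ring m A" and p: "p \<in> mpol_ring l"
    and g: "\<And>i. i < l \<Longrightarrow> g i \<in> mpol_ring m" and g': "\<And>i. i < l \<Longrightarrow> g' i \<in> mpol_ring m"
    and c: "\<And>i. i < l \<Longrightarrow> g i - g' i \<in> A"
  shows "mpol_eval Const g p - mpol_eval Const g' p \<in> A"
proof -
  have 0: "0 \<in> A" using A by (simp add: ideal_of_mpol_ring_def)
  have pow: "g i ^ n - g' i ^ n \<in> A" if "i < l" for i n
  proof (induction n)
    case (Suc n)
    then show ?case
      using that ideal_of_mpol_ring_cong_mult[OF A, of "g' i" "g i ^ n" "g i" "g' i ^ n"]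
      by (simp add: c g g' mpol_ring_pow)
  qed (simp add: 0)
  have prods: "prod (\<lambda>i. g i ^ n i) B - prod (\<lambda>i. g' i ^ n i) B \<in> A"
    if "B \<subseteq> {..<l}" for B and n :: "nat \<Rightarrow> nat"
    using that
  proof (induction B rule: infinite_finite_induct)
    case (insert i B)
    then have "prod (\<lambda>i. g i ^ n i) B \<in> mpol_ring m" "g' i ^ n i \<in> mpol_ring m"
      by (auto intro!: mpol_ring_prod mpol_ring_pow g g')
    with insert show ?case
      using ideal_of_mpol_ring_cong_mult[OF A, of "g' i ^ n i" "prod (\<lambda>i. g i ^ n i) B" "g i ^ n i"
          "prod (\<lambda>i. g' i ^ n i) B"]
      by (simp add: pow)
  qed (simp_all add: 0)
  show ?thesis
    unfolding mpol_eval_def sum_subtractf[symmetric] right_diff_distrib[symmetric]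
  proof (rule ideal_of_mpol_ring_sum[OF A])
    fix a assume "a \<in> Poly_Mapping.keys p"
    then have "Poly_Mapping.keys a \<subseteq> {..<l}" using p by (simp add: mpol_ring_def)
    from prods[OF this, of "Poly_Mapping.lookup a"]
    show "Const (Poly_Mapping.lookup p a) *
        ((\<Prod>v\<in>Poly_Mapping.keys a. g v ^ Poly_Mapping.lookup a v) -
         (\<Prod>v\<in>Poly_Mapping.keys a. g' v ^ Poly_Mapping.lookup a v)) \<in> A"
      using A mpol_ring_Const unfolding ideal_of_mpol_ring_def by blast
  qed
qed


lemma linear_relation_in: 
  assumes "(\<Sum>i<length fs. a i * fs ! i) = 0"
  shows "(\<Sum>i<length fs. Const (a i) * Var i) \<in> linear_rees_ideal fs"
proof -
  have "(\<Sum>i<length fs. Const (a i) * Var i) \<in> linear_relations fs"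
    using assms by (auto simp: linear_relations_def)
  then show ?thesis
    unfolding linear_rees_ideal_def by (rule hull_inc)
qed

lemma span_set_coeffs:
  assumes "x \<in> ideal.span (set gs)"
  shows "\<exists>d. x = (\<Sum>j<length gs. d j * gs ! j)"
proof -
  have "ideal.subspace {\<Sum>j<length gs. d j * gs ! j |d. True}" (is "ideal.subspace ?S")
  proof (rule ideal.subspaceI)
    show "0 \<in> ?S" by (auto intro!: exI[of _ "\<lambda>_. 0"])
  next
    fix x y assume "x \<in> ?S" "y \<in> ?S"
    then obtain d e where "x = (\<Sum>j<length gs. d j * gs ! j)" "y = (\<Sum>j<length gs. e j * gs ! j)"
      by auto
    then have "x + y = (\<Sum>j<length gs. (d j + e j) * gs ! j)"
      by (simp add: sum.distrib distrib_right)
    then show "x + y \<in> ?S" by (intro CollectI exI[of _ "\<lambda>j. d j + e j"]) simp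
  next
    fix c x assume "x \<in> ?S"
    then obtain d where "x = (\<Sum>j<length gs. d j * gs ! j)" by auto
    then have "c * x = (\<Sum>j<length gs. (c * d j) * gs ! j)"
      by (simp add: sum_distrib_left mult.assoc)
    then show "c * x \<in> ?S" by (intro CollectI exI[of _ "\<lambda>j. c * d j"]) simp
  qed
  moreover have "set gs \<subseteq> ?S"
  proof
    fix x assume "x \<in> set gs"
    then obtain k where "k < length gs" "x = gs ! k" by (auto simp: in_set_conv_nth)
    then have "x = (\<Sum>j<length gs. (if j = k then 1 else 0) * gs ! j)"
      by (simp add: if_distrib[of "\<lambda>c. c * _"] sum.delta cong: if_cong)
    then show "x \<in> ?S" by (intro CollectI exI[of _ "\<lambda>j. if j = k then 1 else 0"]) simp
  qed
  ultimately have "ideal.span (set gs) \<subseteq> ?S" by (intro ideal.span_minimal)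
  then show ?thesis using assms by auto
qed

lemma rees_map_linear:
  "rees_map gs (\<Sum>j<length gs. Const (d j) * Var j) = [:0, \<Sum>j<length gs. d j * gs ! j:]"
proof -
  have pc: "(\<Sum>j<l. [:0, e j:]) = [:0, \<Sum>j<(l::nat). e j:]" for l and e :: "nat \<Rightarrow> 'a"
    by (induction l) simp_all
  show ?thesis
    unfolding rees_map_def
    by (simp only: coeff_hom.eval_sum[OF coeff_hom_poly] coeff_hom.eval_mult[OF coeff_hom_poly]
        coeff_hom.eval_Const[OF coeff_hom_poly] coeff_hom.eval_Var[OF coeff_hom_poly]) (simp add: pc mult.commute)
qed

lemma conductor_gens_mono:
  fixes fs gs :: "'r::comm_ring_1 list"
  assumes eq: "ideal.span (set fs) = ideal.span (set gs)"
  shows "conductor_gens gs \<subseteq> conductor_gens fs"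
proof -
  let ?m = "length fs" and ?l = "length gs"
  have "\<exists>d. fs ! i = (\<Sum>j<?l. d j * gs ! j)" if "i < ?m" for i
    using that eq ideal.span_base[of "fs ! i" "set fs"] by (intro span_set_coeffs) auto
  then obtain d where d: "\<And>i. i < ?m \<Longrightarrow> fs ! i = (\<Sum>j<?l. d i j * gs ! j)" by metis
  have "\<exists>c. gs ! j = (\<Sum>i<?m. c i * fs ! i)" if "j < ?l" for j
    using that eq ideal.span_base[of "gs ! j" "set gs"] by (intro span_set_coeffs) auto
  then obtain c where c: "\<And>j. j < ?l \<Longrightarrow> gs ! j = (\<Sum>i<?m. c j i * fs ! i)" by metis
  define t where "t i = (\<Sum>j<?l. Const (d i j) * (Var j :: (nat, 'r) mpol))" for i
  define s where "s j = (\<Sum>i<?m. Const (c j i) * (Var i :: (nat, 'r) mpol))" for j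
  interpret K: coeff_hom "Const :: 'r \<Rightarrow> (nat, 'r) mpol" by (rule coeff_hom_Const)
  interpret S: coeff_hom "mpol_eval Const s" by (rule K.coeff_hom_eval)
  interpret P: coeff_hom "rees_map gs" by (rule coeff_hom_rees_map)
  note L = ideal_of_mpol_ring_linear[of fs]
  have tT: "t i \<in> mpol_ring ?l" for i
    unfolding t_def by (intro mpol_ring_sum mpol_ring_mult mpol_ring_Const mpol_ring_Var) simp
  have sT: "s j \<in> mpol_ring ?m" for j
    unfolding s_def by (intro mpol_ring_sum mpol_ring_mult mpol_ring_Const mpol_ring_Var) simp
  have sL: "mpol_eval Const s p \<in> linear_rees_ideal fs" if "p \<in> linear_rees_ideal gs" for p
  proof -
    let ?A = "{p \<in> mpol_ring ?l. mpol_eval Const s p \<in> linear_rees_ideal fs}"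
    have "ideal_of_mpol_ring ?l ?A"
      using L unfolding ideal_of_mpol_ring_def
      by (auto simp: S.h0 S.hadd S.hmult mpol_ring_0 mpol_ring_add mpol_ring_mult
          intro!: mpol_ring_eval sT)
    moreover have "linear_relations gs \<subseteq> ?A"
    proof
      fix p assume p: "p \<in> linear_relations gs"
      then obtain a where a: "p = (\<Sum>j<?l. Const (a j) * Var j)" "(\<Sum>j<?l. a j * gs ! j) = 0"
        by (auto simp: linear_relations_def)
      have "mpol_eval Const s p = (\<Sum>j<?l. Const (a j) * s j)"
        unfolding a(1) by (simp only: S.hsum S.hmult K.eval_Const K.eval_Var)
      also have "\<dots> = (\<Sum>j<?l. \<Sum>i<?m. Const (a j * c j i) * Var i)"
        by (simp only: s_def sum_distrib_left K.hmult mult.assoc)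
      also have "\<dots> = (\<Sum>i<?m. Const (\<Sum>j<?l. a j * c j i) * Var i)"
        by (subst sum.swap) (simp only: K.hsum sum_distrib_right)
      finally have e: "mpol_eval Const s p = \<dots>" .
      have "(\<Sum>i<?m. (\<Sum>j<?l. a j * c j i) * fs ! i) = (\<Sum>i<?m. \<Sum>j<?l. a j * (c j i * fs ! i))"
        by (simp add: sum_distrib_right mult.assoc)
      also have "\<dots> = (\<Sum>j<?l. a j * (\<Sum>i<?m. c j i * fs ! i))"
        by (subst sum.swap) (simp add: sum_distrib_left)
      also have "\<dots> = (\<Sum>j<?l. a j * gs ! j)"
        by (intro sum.cong) (simp_all add: c)
      finally have "mpol_eval Const s p \<in> linear_rees_ideal fs"
        unfolding e using a(2) by (intro linear_relation_in) simp
      then show "p \<in> ?A" using p linear_relations_subset by auto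
    qed
    ultimately have "linear_rees_ideal gs \<subseteq> ?A"
      unfolding linear_rees_ideal_def[of gs] by (intro hull_minimal)
    then show ?thesis using that by auto
  qed
  have st: "mpol_eval Const s (t i) - Var i \<in> linear_rees_ideal fs" if i: "i < ?m" for i
  proof -
    let ?a = "\<lambda>k. (\<Sum>j<?l. d i j * c j k) - (if k = i then 1 else 0)"
    have "mpol_eval Const s (t i) = (\<Sum>j<?l. Const (d i j) * s j)"
      unfolding t_def by (simp only: S.hsum S.hmult K.eval_Const K.eval_Var)
    also have "\<dots> = (\<Sum>j<?l. \<Sum>k<?m. Const (d i j * c j k) * Var k)"
      by (simp only: s_def sum_distrib_left K.hmult mult.assoc)
    also have "\<dots> = (\<Sum>k<?m. Const (\<Sum>j<?l. d i j * c j k) * Var k)"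
      by (subst sum.swap) (simp only: K.hsum sum_distrib_right)
    finally have e1: "mpol_eval Const s (t i) = \<dots>" .
    have "Var i = (\<Sum>k<?m. if k = i then Var k else (0 :: (nat, 'r) mpol))"
      using i by (simp add: sum.delta)
    also have "\<dots> = (\<Sum>k<?m. Const (if k = i then 1 else 0) * (Var k :: (nat, 'r) mpol))"
      by (intro sum.cong) (simp_all add: mult_single)
    finally have e: "mpol_eval Const s (t i) - Var i = (\<Sum>k<?m. Const (?a k) * Var k)"
      unfolding e1 by (simp only: single_diff sum_subtractf left_diff_distrib)
    have "(\<Sum>k<?m. (\<Sum>j<?l. d i j * c j k) * fs ! k) = (\<Sum>k<?m. \<Sum>j<?l. d i j * (c j k * fs ! k))"
      by (simp add: sum_distrib_right mult.assoc)
    also have "\<dots> = (\<Sum>j<?l. d i j * (\<Sum>k<?m. c j k * fs ! k))"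
      by (subst sum.swap) (simp add: sum_distrib_left)
    also have "\<dots> = (\<Sum>j<?l. d i j * gs ! j)"
      by (intro sum.cong) (simp_all add: c)
    also have "\<dots> = fs ! i" using d[OF i] by simp
    finally have "(\<Sum>k<?m. (\<Sum>j<?l. d i j * c j k) * fs ! k) = fs ! i" .
    moreover have "(\<Sum>k<?m. (if k = i then 1 else 0) * fs ! k) = fs ! i"
      using i by (simp add: if_distrib[of "\<lambda>c. c * _"] sum.delta cong: if_cong)
    ultimately have "(\<Sum>k<?m. ?a k * fs ! k) = 0"
      by (simp only: left_diff_distrib sum_subtractf) simp
    then show ?thesis unfolding e by (rule linear_relation_in)
  qed
  show ?thesis
  proof
    fix r assume r: "r \<in> conductor_gens gs"
    show "r \<in> conductor_gens fs"
      unfolding conductor_gens_def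
    proof safe
      fix p assume p: "p \<in> rees_ideal fs"
      then have pT: "p \<in> mpol_ring ?m" by (simp add: rees_ideal_def)
      define q where "q = mpol_eval Const t p"
      have "rees_map gs q = mpol_eval (\<lambda>c. rees_map gs (Const c)) (\<lambda>i. rees_map gs (t i)) p"
        unfolding q_def by (rule P.comp_eval)
      also have "(\<lambda>c. rees_map gs (Const c)) = (\<lambda>c. [:c:])"
        unfolding rees_map_def by (simp add: coeff_hom.eval_Const[OF coeff_hom_poly])
      also have "mpol_eval (\<lambda>c. [:c:]) (\<lambda>i. rees_map gs (t i)) p = rees_map fs p"
        unfolding rees_map_def[of fs]
        by (rule eval_cong[OF pT]) (simp only: t_def rees_map_linear d)
      also have "\<dots> = 0" using p by (simp add: rees_ideal_def)
      finally have "q \<in> rees_ideal gs"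
        unfolding rees_ideal_def q_def using pT tT by (auto intro: mpol_ring_eval)
      then have "Const r * q \<in> linear_rees_ideal gs"
        using r by (auto simp: conductor_gens_def)
      from sL[OF this] have 1: "Const r * mpol_eval Const s q \<in> linear_rees_ideal fs"
        by (simp only: S.hmult K.eval_Const)
      have "mpol_eval Const s q = mpol_eval Const (\<lambda>i. mpol_eval Const s (t i)) p"
        unfolding q_def S.comp_eval K.eval_Const ..
      moreover have "mpol_eval Const (\<lambda>i. mpol_eval Const s (t i)) p - mpol_eval Const Var p
          \<in> linear_rees_ideal fs"
        by (rule eval_congruent[OF L pT mpol_ring_eval[OF tT sT] mpol_ring_Var st])
      ultimately have "mpol_eval Const s q - p \<in> linear_rees_ideal fs"
        by (simp only: eval_Const_Var)
      then have "Const (- r) * (mpol_eval Const s q - p) \<in> linear_rees_ideal fs"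
        using L mpol_ring_Const unfolding ideal_of_mpol_ring_def by blast
      with 1 have "Const r * mpol_eval Const s q + Const (- r) * (mpol_eval Const s q - p)
          \<in> linear_rees_ideal fs"
        using L unfolding ideal_of_mpol_ring_def by blast
      then show "Const r * p \<in> linear_rees_ideal fs"
        by (simp add: single_uminus algebra_simps)
    qed
  qed
qed

theorem conductor_eq: "ideal.span (set fs) = I \<Longrightarrow> conductor I = conductor_gens fs"
  unfolding conductor_def
  by (rule someI2[of _ fs]) (auto intro!: subset_antisym conductor_gens_mono)

end

theory Submission
  imports Defs "HOL-Library.Product_Plus"
begin

text \<open>
  By the hypothesis on \<open>u\<close>, the ideal \<open>I\<close> has finitely many monomial generators \<open>f\<^sub>i\<close> coprime to
  \<open>u\<close>. Let \<open>J\<close>, \<open>L\<close> and \<open>J'\<close>, \<open>L'\<close> be the Rees ideals and linear Rees ideals of \<open>(f\<^sub>i)\<close> and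
  \<open>(f\<^sub>i, u)\<close>, with the additional variable \<open>z\<close> for \<open>u\<close>. The relations
  \<open>u y\<^sub>i - f\<^sub>i z\<close> in \<open>L'\<close> reduce binomials in \<open>J'\<close> to binomials in \<open>J\<close>, so \<open>r J' \<subseteq> L'\<close>
  is equivalent to \<open>r J \<subseteq> L'\<close>; in particular the conductor of \<open>I\<close> is contained in that of
  \<open>(I, u)\<close>.

  Modulo \<open>L'\<close>, a form \<open>F(y)\<close> of degree \<open>d\<close> satisfies \<open>u\<^sup>d F(y) = F(f) z\<^sup>d\<close>, which vanishes for \<open>F\<close> in
  \<open>J\<close>. As \<open>J\<close> is generated by finitely many binomials, some \<open>u\<^sup>k\<close> works for all of \<open>J\<close>.

  For the other inclusion, let \<open>r J \<subseteq> L'\<close> and let \<open>D\<close> be the operator that removes the terms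
  divisible by \<open>u\<close>. It commutes with multiplication by monomials coprime to \<open>u\<close>, so applying it
  to the coefficients and setting \<open>z = 0\<close> maps \<open>L'\<close> into \<open>L\<close> and \<open>r F\<close> to \<open>D(r) F\<close> for every binomial
  \<open>F\<close> in \<open>J\<close> with coefficients coprime to \<open>u\<close>. These generate \<open>J\<close>, hence \<open>D(r)\<close> lies in the
  conductor of \<open>I\<close>, and \<open>r - D(r)\<close> is a multiple of \<open>u\<close>.
\<close>

subsection \<open>Exponents and the binomials of a Rees ideal\<close>

abbreviation xmon :: "('v \<Rightarrow>\<^sub>0 nat) \<Rightarrow> ('v, 'r::zero_neq_one) mpol" where
  "xmon a \<equiv> Poly_Mapping.single a 1"

lemma exponent_dvd_iff:
  fixes a w :: "'v \<Rightarrow>\<^sub>0 nat"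
  shows "(\<exists>b. a = w + b) \<longleftrightarrow> (\<forall>v. Poly_Mapping.lookup w v \<le> Poly_Mapping.lookup a v)"
proof
  assume "\<forall>v. Poly_Mapping.lookup w v \<le> Poly_Mapping.lookup a v"
  then have "a = w + (a - w)"
    by (intro poly_mapping_eqI) (simp add: lookup_add lookup_minus)
  then show "\<exists>b. a = w + b" ..
qed (auto simp: lookup_add)

text \<open>Dickson's lemma for the tuples \<open>f s\<close> indexed by \<open>X\<close>. In the
  induction step, a set \<open>H\<close> that suffices for \<open>X\<close> covers every
  \<open>s\<close> whose new coordinate is at least the maximum \<open>N\<close> over
  \<open>H\<close>; the other \<open>s\<close> lie in finitely many slices with constant new
  coordinate, each covered by the induction hypothesis.\<close>

lemma dickson:
  fixes f :: "'a \<Rightarrow> 'i \<Rightarrow> nat"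
  assumes "finite X"
  shows "\<exists>H. finite H \<and> H \<subseteq> S \<and> (\<forall>s\<in>S. \<exists>h\<in>H. \<forall>i\<in>X. f h i \<le> f s i)"
  using assms
proof (induction X arbitrary: S rule: finite_induct)
  case empty
  show ?case
  proof (cases "S = {}")
    case False
    then obtain s where "s \<in> S" by blast
    then show ?thesis by (intro exI[of _ "{s}"]) auto
  qed auto
next
  case (insert x X)
  obtain H where H: "finite H" "H \<subseteq> S" "\<forall>s\<in>S. \<exists>h\<in>H. \<forall>i\<in>X. f h i \<le> f s i"
    using insert.IH[of S] by blast
  define Q where "Q k G \<longleftrightarrow> finite G \<and> G \<subseteq> {s\<in>S. f s x = k} \<and>
      (\<forall>s\<in>{s\<in>S. f s x = k}. \<exists>h\<in>G. \<forall>i\<in>X. f h i \<le> f s i)" for k G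
  have "\<exists>G. Q k G" for k
    unfolding Q_def by (rule insert.IH)
  then have "\<forall>k. \<exists>G. Q k G" ..
  then obtain G where "\<forall>k. Q k (G k)" by (rule choice[THEN exE])
  then have G: "\<And>k. finite (G k)" "\<And>k. G k \<subseteq> {s\<in>S. f s x = k}"
    "\<And>s. s \<in> S \<Longrightarrow> \<exists>h\<in>G (f s x). \<forall>i\<in>X. f h i \<le> f s i"
    unfolding Q_def by blast+
  \<comment> \<open>The inserted 0 makes the maximum meaningful for empty \<open>H\<close>.\<close>
  define N where "N = Max (insert 0 ((\<lambda>h. f h x) ` H))"
  have N: "f h x \<le> N" if "h \<in> H" for h
    using that H(1) by (simp add: N_def)
  show ?case
  proof (intro exI[of _ "H \<union> (\<Union>k<N. G k)"] conjI ballI)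
    fix s assume s: "s \<in> S"
    show "\<exists>h\<in>H \<union> (\<Union>k<N. G k). \<forall>i\<in>insert x X. f h i \<le> f s i"
    proof (cases "f s x < N")
      case True
      obtain h where "h \<in> G (f s x)" "\<forall>i\<in>X. f h i \<le> f s i" using G(3)[OF s] by blast
      moreover from this have "f h x = f s x" using G(2) by blast
      ultimately show ?thesis using True by (intro bexI[of _ h]) auto
    next
      case False
      obtain h where "h \<in> H" "\<forall>i\<in>X. f h i \<le> f s i" using H(3) s by blast
      with False show ?thesis using N[of h] by (intro bexI[of _ h]) auto
    qed
  qed (use H(1,2) G(1,2) in \<open>auto dest: subsetD\<close>)
qed

lemma single_sum: "Poly_Mapping.single a (sum f A) = (\<Sum>x\<in>A. Poly_Mapping.single a (f x))"
  by (induction A rule: infinite_finite_induct) (simp_all add: single_add)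

section \<open>Terms of T and their images under the Rees map\<close>

definition total :: "nat \<Rightarrow> (nat \<Rightarrow>\<^sub>0 nat) \<Rightarrow> nat" where
  "total n b = (\<Sum>i<n. Poly_Mapping.lookup b i)"

definition weight :: "('n \<Rightarrow>\<^sub>0 nat) list \<Rightarrow> (nat \<Rightarrow>\<^sub>0 nat) \<Rightarrow> ('n \<Rightarrow>\<^sub>0 nat)" where
  "weight es b = (\<Sum>i<length es. Poly_Mapping.map ((*) (Poly_Mapping.lookup b i)) (es ! i))"

text \<open>A pair \<open>(b, a)\<close> stands for the term x^a y^b, so products of terms are sums
  of pairs. The substitution y_i -> f_i t with monomials f_i sends it to a term again, whose
  exponents in x and in t are recorded here.\<close>

definition image_exp ::
  "('n \<Rightarrow>\<^sub>0 nat) list \<Rightarrow> (nat \<Rightarrow>\<^sub>0 nat) \<times> ('n \<Rightarrow>\<^sub>0 nat) \<Rightarrow> ('n \<Rightarrow>\<^sub>0 nat) \<times> nat" where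
  "image_exp es s = (snd s + weight es (fst s), total (length es) (fst s))"

definition mterm :: "(nat \<Rightarrow>\<^sub>0 nat) \<times> ('n \<Rightarrow>\<^sub>0 nat) \<Rightarrow> 'k \<Rightarrow> (nat, ('n, 'k::comm_ring_1) mpol) mpol" where
  "mterm s c = Poly_Mapping.single (fst s) (Poly_Mapping.single (snd s) c)"

lemma lookup_map_mult: "Poly_Mapping.lookup (Poly_Mapping.map ((*) k) e) v = k * Poly_Mapping.lookup e v"
  for k :: nat
  by (simp add: Poly_Mapping.map.rep_eq when_def)

lemma lookup_weight:
  "Poly_Mapping.lookup (weight es b) v = (\<Sum>i<length es. Poly_Mapping.lookup b i * Poly_Mapping.lookup (es ! i) v)"
  by (simp add: weight_def lookup_sum lookup_map_mult)

lemma total_add: "total n (b + b') = total n b + total n b'"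
  by (simp add: total_def lookup_add sum.distrib)

lemma weight_add: "weight es (b + b') = weight es b + weight es b'"
  by (rule poly_mapping_eqI) (simp add: lookup_weight lookup_add distrib_right sum.distrib)

lemma image_exp_add: "image_exp es (s + s') = image_exp es s + image_exp es s'"
  by (simp add: image_exp_def weight_add total_add algebra_simps)

lemma total_single: "i < n \<Longrightarrow> total n (Poly_Mapping.single i k) = k"
  by (simp add: total_def lookup_single when_def sum.delta)

lemma weight_single: "i < length es \<Longrightarrow> weight es (Poly_Mapping.single i 1) = es ! i"
  by (rule poly_mapping_eqI)
    (simp add: lookup_weight lookup_single when_def if_distrib[of "\<lambda>c. c * _"] sum.delta cong: if_cong)

lemma mterm_add: "mterm (s + s') (c * c') = mterm s c * mterm s' c'"
  by (simp add: mterm_def mult_single)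

lemma mterm_in_mpol_ring: "Poly_Mapping.keys (fst s) \<subseteq> {..<m} \<Longrightarrow> mterm s c \<in> mpol_ring m"
  by (simp add: mterm_def mpol_ring_def)

lemma xmon_power: "(xmon e :: ('v, 'r::comm_ring_1) mpol) ^ k = xmon (Poly_Mapping.map ((*) k) e)"
proof (induction k)
  case 0
  have "Poly_Mapping.map ((*) 0) e = 0"
    by (rule poly_mapping_eqI) (simp add: lookup_map_mult)
  then show ?case by (simp only: power_0 single_one)
next
  case (Suc k)
  have "e + Poly_Mapping.map ((*) k) e = Poly_Mapping.map ((*) (Suc k)) e"
    by (rule poly_mapping_eqI) (simp add: lookup_map_mult lookup_add)
  then show ?case by (simp only: power_Suc Suc mult_single mult_1)
qed

lemma rees_map_single:
  fixes es :: "('n \<Rightarrow>\<^sub>0 nat) list"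
  assumes "Poly_Mapping.keys b \<subseteq> {..<length es}"
  shows "rees_map (map xmon es) (Poly_Mapping.single b (c :: ('n, 'k::comm_ring_1) mpol)) =
    monom (c * xmon (weight es b)) (total (length es) b)"
proof -
  have pw: "[:0, f:] ^ k = monom (f ^ k) k" for f :: "('n, 'k) mpol" and k
  proof (induction k)
    case (Suc k)
    have "[:0, f:] = monom f 1" by (simp add: monom_altdef)
    then show ?case unfolding power_Suc Suc by (simp only: mult_monom) simp
  qed simp
  have "(\<Prod>v\<in>Poly_Mapping.keys b. [:0, map xmon es ! v:] ^ Poly_Mapping.lookup b v) =
      (\<Prod>v<length es. [:0, map (xmon :: _ \<Rightarrow> ('n, 'k) mpol) es ! v:] ^ Poly_Mapping.lookup b v)"
    using assms by (intro monom_eval_superset) simp_all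
  also have "\<dots> = (\<Prod>v<length es. monom (xmon (Poly_Mapping.map ((*) (Poly_Mapping.lookup b v)) (es ! v)))
      (Poly_Mapping.lookup b v))"
    by (intro prod.cong) (simp_all add: pw xmon_power)
  also have "(\<Prod>v<n. monom (xmon (e v) :: ('n, 'k) mpol) (k v)) = monom (xmon (\<Sum>v<n. e v)) (\<Sum>v<n. k v)"
    for e k and n :: nat
    by (induction n) (simp_all add: mult_monom mult_single add.commute)
  finally show ?thesis
    unfolding rees_map_def coeff_hom.eval_single[OF coeff_hom_poly]
    by (simp add: weight_def total_def smult_monom)
qed

lemma rees_map_mterm:
  assumes "Poly_Mapping.keys (fst s) \<subseteq> {..<length es}"
  shows "rees_map (map xmon es) (mterm s c) =
    monom (Poly_Mapping.single (fst (image_exp es s)) c) (snd (image_exp es s))"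
  using assms by (simp add: mterm_def rees_map_single mult_single image_exp_def)

lemma binomial_in_rees_ideal:
  assumes "Poly_Mapping.keys (fst s) \<subseteq> {..<length es}" "Poly_Mapping.keys (fst s') \<subseteq> {..<length es}"
    and "image_exp es s = image_exp es s'"
  shows "mterm s (c :: 'k::comm_ring_1) - mterm s' c \<in> rees_ideal (map xmon (es :: ('n \<Rightarrow>\<^sub>0 nat) list))"
proof -
  interpret coeff_hom "rees_map (map xmon es) :: _ \<Rightarrow> ('n, 'k) mpol poly" by (rule coeff_hom_rees_map)
  have 1: "mterm s c + mterm s' (- c) \<in> mpol_ring (length es)"
    by (intro mpol_ring_add mterm_in_mpol_ring assms)
  have 2: "mterm s' (- c) = - mterm s' c" by (simp add: mterm_def single_uminus)
  have "rees_map (map xmon es) (mterm s c + mterm s' (- c)) = 0"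
    unfolding hadd rees_map_mterm[OF assms(1)] rees_map_mterm[OF assms(2)] assms(3)
    by (simp add: add_monom single_add[symmetric])
  with 1 show ?thesis unfolding 2 rees_ideal_def by simp
qed

text \<open>The Rees map sends terms to terms, so the coefficients of \<open>F\<close> sum to 0 over
  each fibre of \<open>image_exp\<close>; subtracting from every term its fibre representative with
  the same coefficient therefore does not change \<open>F\<close>. The additive set \<open>A\<close>
  turns this into an induction rule for claims such as r p \<in> L.\<close>

lemma rees_ideal_binomials:
  fixes es :: "('n \<Rightarrow>\<^sub>0 nat) list" and F :: "(nat, ('n, 'k::comm_ring_1) mpol) mpol"
  assumes F: "F \<in> rees_ideal (map xmon es)"
    and A0: "0 \<in> A" and A_add: "\<And>x y. x \<in> A \<Longrightarrow> y \<in> A \<Longrightarrow> x + y \<in> A"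
    and A: "\<And>s s' c. \<lbrakk>Poly_Mapping.keys (fst s) \<subseteq> {..<length es}; Poly_Mapping.keys (fst s') \<subseteq> {..<length es};
      image_exp es s = image_exp es s'\<rbrakk> \<Longrightarrow> mterm s c - mterm s' c \<in> A"
  shows "F \<in> A"
proof -
  interpret P: coeff_hom "rees_map (map xmon es) :: _ \<Rightarrow> ('n, 'k) mpol poly" by (rule coeff_hom_rees_map)
  define S where "S = Sigma (Poly_Mapping.keys F) (\<lambda>b. Poly_Mapping.keys (Poly_Mapping.lookup F b))"
  define c where "c s = Poly_Mapping.lookup (Poly_Mapping.lookup F (fst s)) (snd s)" for s
  have fin: "finite S" by (simp add: S_def)
  have SF: "F = (\<Sum>s\<in>S. mterm s (c s))"
  proof -
    have expand: "Poly_Mapping.single b (Poly_Mapping.lookup F b) =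
        (\<Sum>a\<in>Poly_Mapping.keys (Poly_Mapping.lookup F b). mterm (b, a) (c (b, a)))" for b
      unfolding mterm_def c_def fst_conv snd_conv single_sum[symmetric]
      by (rule arg_cong[where f = "Poly_Mapping.single b", OF mpol_expand])
    have "F = (\<Sum>b\<in>Poly_Mapping.keys F. Poly_Mapping.single b (Poly_Mapping.lookup F b))"
      by (rule mpol_expand)
    also have "\<dots> = (\<Sum>b\<in>Poly_Mapping.keys F. \<Sum>a\<in>Poly_Mapping.keys (Poly_Mapping.lookup F b).
        mterm (b, a) (c (b, a)))"
      by (intro sum.cong refl expand)
    also have "\<dots> = (\<Sum>s\<in>S. mterm s (c s))"
      unfolding S_def by (subst sum.Sigma) (auto intro!: sum.cong)
    finally show ?thesis .
  qed
  have keys: "Poly_Mapping.keys (fst s) \<subseteq> {..<length es}" if "s \<in> S" for s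
    using that F unfolding S_def rees_ideal_def mpol_ring_def by auto
  define rep where "rep w = (SOME s. s \<in> S \<and> image_exp es s = w)" for w
  have rep: "rep (image_exp es s) \<in> S \<and> image_exp es (rep (image_exp es s)) = image_exp es s" if "s \<in> S" for s
    unfolding rep_def by (rule someI[of _ s]) (use that in auto)
  \<comment> \<open>This sum is the coefficient of the term with exponents \<open>w\<close> in the
    image of \<open>F\<close>.\<close>
  have zero: "(\<Sum>s\<in>{s\<in>S. image_exp es s = w}. c s) = 0" for w
  proof -
    have "0 = rees_map (map xmon es) F" using F by (simp add: rees_ideal_def)
    also have "\<dots> = (\<Sum>s\<in>S. rees_map (map xmon es) (mterm s (c s)))"
      unfolding P.hsum[symmetric] by (rule arg_cong[where f = "rees_map (map xmon es)", OF SF])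
    also have "\<dots> = (\<Sum>s\<in>S. monom (Poly_Mapping.single (fst (image_exp es s)) (c s)) (snd (image_exp es s)))"
      by (intro sum.cong refl rees_map_mterm keys)
    finally have "0 = Poly_Mapping.lookup (coeff \<dots> (snd w)) (fst w)" by simp
    also have "\<dots> = (\<Sum>s\<in>S. if image_exp es s = w then c s else 0)"
      by (auto simp: coeff_sum lookup_sum lookup_single when_def prod_eq_iff intro!: sum.cong)
    finally show ?thesis using fin by (simp add: sum.inter_filter)
  qed
  have "(\<Sum>s\<in>S. mterm (rep (image_exp es s)) (c s)) =
      (\<Sum>w\<in>image_exp es ` S. \<Sum>s\<in>{s\<in>S. image_exp es s = w}. mterm (rep (image_exp es s)) (c s))"
    by (rule sum.image_gen[OF fin])
  also have "\<dots> = (\<Sum>w\<in>image_exp es ` S. mterm (rep w) (\<Sum>s\<in>{s\<in>S. image_exp es s = w}. c s))"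
    by (intro sum.cong refl) (simp add: mterm_def single_sum)
  also have "\<dots> = 0" by (simp add: zero mterm_def)
  finally have "F = (\<Sum>s\<in>S. mterm s (c s) - mterm (rep (image_exp es s)) (c s))"
    using SF by (simp add: sum_subtractf)
  also have "\<dots> \<in> A"
  proof -
    have closed: "sum f X \<in> A" if "\<And>x. x \<in> X \<Longrightarrow> f x \<in> A" for f and X :: "((nat \<Rightarrow>\<^sub>0 nat) \<times> ('n \<Rightarrow>\<^sub>0 nat)) set"
      using that by (induction X rule: infinite_finite_induct) (auto intro: A0 A_add)
    show ?thesis
    proof (rule closed)
      fix s assume s: "s \<in> S"
      show "mterm s (c s) - mterm (rep (image_exp es s)) (c s) \<in> A"
        using rep[OF s] by (intro A keys s) simp_all
    qed
  qed
  finally show ?thesis .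
qed

subsection \<open>Adjoining a coprime monomial\<close>

lemma ideal_of_mpol_ring_add: "ideal_of_mpol_ring m A \<Longrightarrow> p \<in> A \<Longrightarrow> q \<in> A \<Longrightarrow> p + q \<in> A"
  by (simp add: ideal_of_mpol_ring_def)

lemma ideal_of_mpol_ring_mult: "ideal_of_mpol_ring m A \<Longrightarrow> p \<in> mpol_ring m \<Longrightarrow> q \<in> A \<Longrightarrow> p * q \<in> A"
  by (simp add: ideal_of_mpol_ring_def)

lemma ideal_of_mpol_ring_uminus: "ideal_of_mpol_ring m A \<Longrightarrow> p \<in> A \<Longrightarrow> - p \<in> A"
  using ideal_of_mpol_ring_mult[of m A "Const (- 1)" p, OF _ mpol_ring_Const]
  by (simp add: single_uminus)

lemma ideal_of_mpol_ring_diff: "ideal_of_mpol_ring m A \<Longrightarrow> p \<in> A \<Longrightarrow> q \<in> A \<Longrightarrow> p - q \<in> A"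
  using ideal_of_mpol_ring_add[of m A p "- q"] ideal_of_mpol_ring_uminus[of m A q] by simp

lemma mpol_ring_mono: "m \<le> n \<Longrightarrow> mpol_ring m \<subseteq> mpol_ring n"
  unfolding mpol_ring_def by fastforce

lemma linear_rees_ideal_append_subset: "linear_rees_ideal fs \<subseteq> linear_rees_ideal (fs @ gs)"
proof -
  let ?m = "length fs" and ?n = "length (fs @ gs)"
  let ?L = "linear_rees_ideal (fs @ gs)"
  have sub: "mpol_ring ?m \<subseteq> (mpol_ring ?n :: (nat, 'a) mpol set)" by (rule mpol_ring_mono) simp
  \<comment> \<open>The hull ranges over ideals of the smaller ring, so the larger ideal is first
    restricted to that ring.\<close>
  have "ideal_of_mpol_ring ?m (?L \<inter> mpol_ring ?m)"
    using ideal_of_mpol_ring_linear[of "fs @ gs"] sub unfolding ideal_of_mpol_ring_def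
    by (auto simp: mpol_ring_0 mpol_ring_add mpol_ring_mult)
  moreover have "linear_relations fs \<subseteq> ?L \<inter> mpol_ring ?m"
  proof
    fix p assume p: "p \<in> linear_relations fs"
    then obtain a where a: "p = (\<Sum>i<?m. Const (a i) * Var i)" "(\<Sum>i<?m. a i * fs ! i) = 0"
      by (auto simp: linear_relations_def)
    define a' where "a' i = (if i < ?m then a i else 0)" for i
    have "p = (\<Sum>i<?n. Const (a' i) * Var i)"
      unfolding a(1) by (rule sum.mono_neutral_cong_left) (auto simp: a'_def)
    moreover have "(\<Sum>i<?n. a' i * (fs @ gs) ! i) = (\<Sum>i<?m. a i * fs ! i)"
      by (rule sum.mono_neutral_cong_right) (auto simp: a'_def nth_append)
    ultimately show "p \<in> ?L \<inter> mpol_ring ?m"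
      using a(2) p linear_relations_subset linear_relation_in[of a' "fs @ gs"] by auto
  qed
  ultimately have "linear_rees_ideal fs \<subseteq> ?L \<inter> mpol_ring ?m"
    unfolding linear_rees_ideal_def[of fs] by (intro hull_minimal)
  then show ?thesis by blast
qed

lemma rees_ideal_append_subset: "rees_ideal fs \<subseteq> rees_ideal (fs @ gs)"
proof
  fix p assume p: "p \<in> rees_ideal fs"
  then have "p \<in> mpol_ring (length fs)" by (simp add: rees_ideal_def)
  then have "rees_map (fs @ gs) p = rees_map fs p"
    unfolding rees_map_def by (rule eval_cong) (simp add: nth_append)
  then show "p \<in> rees_ideal (fs @ gs)"
    using p mpol_ring_mono[of "length fs" "length (fs @ gs)"] by (auto simp: rees_ideal_def)
qed

text \<open>This comes from u f_j - f_j u = 0; \<open>Var (length fs)\<close> is the new variable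
  z.\<close>

lemma koszul_relation:
  assumes j: "j < length fs"
  shows "Const u * Var j - Const (fs ! j) * Var (length fs) \<in> linear_rees_ideal (fs @ [u])"
proof -
  define a where "a i = (if i = j then u else if i = length fs then - fs ! j else 0)" for i
  have eq: "(\<Sum>i<length (fs @ [u]). F i) = F j + F (length fs)"
    if "\<And>i. i \<noteq> j \<Longrightarrow> i < length fs \<Longrightarrow> F i = 0" for F :: "nat \<Rightarrow> 'b::comm_monoid_add"
  proof -
    have "(\<Sum>i<length fs. F i) = (\<Sum>i\<in>{j}. F i)"
      using j that by (intro sum.mono_neutral_right) auto
    then show ?thesis by simp
  qed
  have "(\<Sum>i<length (fs @ [u]). Const (a i) * Var i) \<in> linear_rees_ideal (fs @ [u])"
  proof (rule linear_relation_in)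
    show "(\<Sum>i<length (fs @ [u]). a i * (fs @ [u]) ! i) = 0"
      by (subst eq) (use j in \<open>auto simp: a_def nth_append mult.commute\<close>)
  qed
  also have "(\<Sum>i<length (fs @ [u]). Const (a i) * Var i) = Const u * Var j - Const (fs ! j) * Var (length fs)"
    by (subst eq) (use j in \<open>auto simp: a_def single_uminus\<close>)
  finally show ?thesis .
qed

lemma lookup_weight_snoc:
  "Poly_Mapping.lookup (weight (es @ [w]) b) v =
     Poly_Mapping.lookup (weight es b) v + Poly_Mapping.lookup b (length es) * Poly_Mapping.lookup w v"
  by (simp add: lookup_weight nth_append)

text \<open>No f_i involves a variable of u, so in the image of a term such variables come only from
  its coefficient and from z.\<close>

lemma lookup_weight_coprime:
  assumes "\<forall>e\<in>set es. Poly_Mapping.keys e \<inter> Poly_Mapping.keys w = {}" "v \<in> Poly_Mapping.keys w"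
  shows "Poly_Mapping.lookup (weight es b) v = 0"
proof -
  have "Poly_Mapping.lookup (es ! i) v = 0" if "i < length es" for i
    using assms nth_mem[OF that] by (meson disjoint_iff in_keys_iff)
  then show ?thesis by (simp add: lookup_weight)
qed

lemma split_variable:
  fixes b :: "'v \<Rightarrow>\<^sub>0 nat"
  assumes "0 < Poly_Mapping.lookup b j"
  obtains b' where "b = Poly_Mapping.single j 1 + b'"
proof -
  have "\<forall>v. Poly_Mapping.lookup (Poly_Mapping.single j 1) v \<le> Poly_Mapping.lookup b v"
    using assms by (simp add: lookup_single when_def)
  then show thesis using exponent_dvd_iff[of b "Poly_Mapping.single j 1"] that by blast
qed

lemma keys_add_nat: "Poly_Mapping.keys (a + b) = Poly_Mapping.keys a \<union> Poly_Mapping.keys b"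
  for a b :: "'v \<Rightarrow>\<^sub>0 nat"
  by (auto simp: in_keys_iff lookup_add)

text \<open>The binomials of J' are treated by induction on their degree in the y_i and z. A Koszul
  relation exchanges u y_j for f_j z, so as soon as one term contains z, the other can be made to
  contain it, and z cancels. A binomial without z lies in J, where the hypothesis on
  \<open>r\<close> applies.\<close>

lemma rees_multiplier_extends:
  fixes es :: "('n \<Rightarrow>\<^sub>0 nat) list" and r :: "('n, 'k::comm_ring_1) mpol"
  assumes coprime: "\<forall>e\<in>set es. Poly_Mapping.keys e \<inter> Poly_Mapping.keys w = {}"
    and r: "\<And>p. p \<in> rees_ideal (map xmon es) \<Longrightarrow> Const r * p \<in> linear_rees_ideal (map xmon (es @ [w]))"
    and p: "p \<in> rees_ideal (map xmon (es @ [w]))"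
  shows "Const r * p \<in> linear_rees_ideal (map xmon (es @ [w]))"
proof -
  let ?m = "length es"
  let ?L = "linear_rees_ideal (map xmon (es @ [w])) :: (nat, ('n, 'k) mpol) mpol set"
  have L: "ideal_of_mpol_ring (Suc ?m) ?L"
    using ideal_of_mpol_ring_linear[of "map xmon (es @ [w])"] by simp
  \<comment> \<open>This relation is symmetric, transitive and stable under multiplication by terms,
    so binomials can be rewritten one term at a time.\<close>
  define D where "D s s' \<longleftrightarrow> (\<forall>c. Const r * (mterm s c - mterm s' c) \<in> ?L)" for s s'
  have D_sym: "D s s'" if "D s' s" for s s'
  proof -
    have "Const r * (mterm s c - mterm s' c) = - (Const r * (mterm s' c - mterm s c))" for c
      by (simp add: algebra_simps)
    then show ?thesis using that ideal_of_mpol_ring_uminus[OF L] by (simp add: D_def)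
  qed
  have D_trans: "D s s'" if "D s t" "D t s'" for s s' t
  proof -
    have "Const r * (mterm s c - mterm s' c) =
        Const r * (mterm s c - mterm t c) + Const r * (mterm t c - mterm s' c)" for c
      by (simp add: algebra_simps)
    then show ?thesis using that ideal_of_mpol_ring_add[OF L] by (simp add: D_def)
  qed
  have D_shift: "D (t + s) (t + s')" if "D s s'" "Poly_Mapping.keys (fst t) \<subseteq> {..<Suc ?m}" for s s' t
  proof -
    have "Const r * (mterm (t + s) c - mterm (t + s') c) = mterm t 1 * (Const r * (mterm s c - mterm s' c))" for c
      using mterm_add[of t s 1 c] mterm_add[of t s' 1 c] by (simp add: algebra_simps)
    then show ?thesis
      using that ideal_of_mpol_ring_mult[OF L mterm_in_mpol_ring] by (simp add: D_def)
  qed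
  have D_koszul: "D ((Poly_Mapping.single j 1, w) + s) ((Poly_Mapping.single ?m 1, es ! j) + s)"
    if "j < ?m" "Poly_Mapping.keys (fst s) \<subseteq> {..<Suc ?m}" for j s
  proof -
    have "Const (xmon w) * Var j - Const (map xmon es ! j) * Var ?m \<in> ?L"
      using koszul_relation[of j "map xmon es" "xmon w"] that(1) by simp
    then have "mterm (Poly_Mapping.single j 1, w) 1 - mterm (Poly_Mapping.single ?m 1, es ! j) 1 \<in> ?L"
      using that(1) by (simp add: mterm_def mult_single)
    then have "(Const r * mterm s c) *
        (mterm (Poly_Mapping.single j 1, w) 1 - mterm (Poly_Mapping.single ?m 1, es ! j) 1) \<in> ?L" for c
      by (intro ideal_of_mpol_ring_mult[OF L] mpol_ring_mult mpol_ring_Const mterm_in_mpol_ring that(2))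
    moreover have "(Const r * mterm s c) *
        (mterm (Poly_Mapping.single j 1, w) 1 - mterm (Poly_Mapping.single ?m 1, es ! j) 1) =
        Const r * (mterm ((Poly_Mapping.single j 1, w) + s) c - mterm ((Poly_Mapping.single ?m 1, es ! j) + s) c)" for c
      using mterm_add[of "(Poly_Mapping.single j 1, w)" s 1 c]
        mterm_add[of "(Poly_Mapping.single ?m 1, es ! j)" s 1 c]
      by (simp add: algebra_simps)
    ultimately show ?thesis by (simp add: D_def)
  qed
  have D: "D s s'" if "Poly_Mapping.keys (fst s) \<subseteq> {..<Suc ?m}" "Poly_Mapping.keys (fst s') \<subseteq> {..<Suc ?m}"
    "image_exp (es @ [w]) s = image_exp (es @ [w]) s'" for s s'
    using that
  proof (induction "total (Suc ?m) (fst s)" arbitrary: s s' rule: less_induct)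
    case less
    let ?n = "total (Suc ?m) (fst s)"
    have both: "D t t'" if t: "Poly_Mapping.keys (fst t) \<subseteq> {..<Suc ?m}" "Poly_Mapping.keys (fst t') \<subseteq> {..<Suc ?m}"
      "image_exp (es @ [w]) t = image_exp (es @ [w]) t'" "total (Suc ?m) (fst t) = ?n"
      "0 < Poly_Mapping.lookup (fst t) ?m" "0 < Poly_Mapping.lookup (fst t') ?m" for t t'
    proof -
      obtain b b' where b: "fst t = Poly_Mapping.single ?m 1 + b" "fst t' = Poly_Mapping.single ?m 1 + b'"
        using split_variable t(5,6) by metis
      let ?z = "(Poly_Mapping.single ?m 1, 0) :: (nat \<Rightarrow>\<^sub>0 nat) \<times> ('n \<Rightarrow>\<^sub>0 nat)"
      have tz: "t = ?z + (b, snd t)" "t' = ?z + (b', snd t')"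
        by (simp_all add: prod_eq_iff b)
      have "image_exp (es @ [w]) (b, snd t) = image_exp (es @ [w]) (b', snd t')"
        using t(3) by (subst (asm) tz(1), subst (asm) tz(2)) (simp only: image_exp_add add_left_cancel)
      moreover have "total (Suc ?m) b < ?n"
        using t(4) by (simp add: b total_add total_single)
      ultimately have "D (b, snd t) (b', snd t')"
        using t(1,2) b by (intro less.hyps) (simp_all add: keys_add_nat)
      then show ?thesis
        by (subst tz(1), subst tz(2)) (rule D_shift, simp_all)
    qed
    \<comment> \<open>Only the first term is known to contain z; a second term without z is traded
      for the term \<open>?t\<close>, which contains it.\<close>
    have one: "D t t'" if t: "Poly_Mapping.keys (fst t) \<subseteq> {..<Suc ?m}" "Poly_Mapping.keys (fst t') \<subseteq> {..<Suc ?m}"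
      "image_exp (es @ [w]) t = image_exp (es @ [w]) t'" "total (Suc ?m) (fst t) = ?n"
      "0 < Poly_Mapping.lookup (fst t) ?m" for t t'
    proof (cases "0 < Poly_Mapping.lookup (fst t') ?m")
      case True
      then show ?thesis using both t by blast
    next
      case False
      \<comment> \<open>Equal images have equal degree, and the degree of \<open>t\<close> is
        positive because of z; so \<open>t'\<close> contains some y_j.\<close>
      have "total (Suc ?m) (fst t') = total (Suc ?m) (fst t)"
        using t(3) by (simp add: image_exp_def)
      moreover have "0 < total (Suc ?m) (fst t)" using t(5) by (simp add: total_def)
      ultimately obtain j where j: "j < Suc ?m" "0 < Poly_Mapping.lookup (fst t') j"
        unfolding total_def by (metis (no_types, lifting) gr0I lessThan_iff sum.neutral)
      with False have jm: "j < ?m" by (metis less_SucE)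
      obtain b where b: "fst t' = Poly_Mapping.single j 1 + b" using split_variable j(2) by metis
      \<comment> \<open>In the variables of u, the image of \<open>t\<close> has at least the
        exponents of u because of z. As \<open>t'\<close> has no z, its coefficient must supply
        them, so u divides this coefficient.\<close>
      have "Poly_Mapping.lookup w v \<le> Poly_Mapping.lookup (snd t') v" for v
      proof (cases "v \<in> Poly_Mapping.keys w")
        case True
        from t(3) have "Poly_Mapping.lookup (snd t + weight (es @ [w]) (fst t)) v =
            Poly_Mapping.lookup (snd t' + weight (es @ [w]) (fst t')) v"
          by (simp add: image_exp_def)
        then have "Poly_Mapping.lookup (snd t') v =
            Poly_Mapping.lookup (snd t) v + Poly_Mapping.lookup (fst t) ?m * Poly_Mapping.lookup w v"
          using False lookup_weight_coprime[OF coprime True] by (simp add: lookup_add lookup_weight_snoc)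
        then show ?thesis using t(5) by (simp add: trans_le_add2)
      qed (simp add: in_keys_iff)
      then obtain a where a: "snd t' = w + a" using exponent_dvd_iff[of "snd t'" w] by blast
      have t': "t' = (Poly_Mapping.single j 1, w) + (b, a)" by (simp add: prod_eq_iff a b)
      let ?t = "(Poly_Mapping.single ?m 1, es ! j) + (b, a)"
      have keys_b: "Poly_Mapping.keys b \<subseteq> {..<Suc ?m}" using t(2) b by (simp add: keys_add_nat)
      have "weight (es @ [w]) (Poly_Mapping.single j 1) = es ! j" "weight (es @ [w]) (Poly_Mapping.single ?m 1) = w"
        using jm weight_single[of j "es @ [w]"] weight_single[of ?m "es @ [w]"] by (simp_all add: nth_append)
      then have "image_exp (es @ [w]) (Poly_Mapping.single j 1, w) =
          image_exp (es @ [w]) (Poly_Mapping.single ?m 1, es ! j)"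
        using jm by (simp add: image_exp_def total_single add.commute)
      then have "image_exp (es @ [w]) t = image_exp (es @ [w]) ?t"
        unfolding t(3) t' image_exp_add by simp
      then have "D t ?t"
        using t keys_b by (intro both) (simp_all add: keys_add_nat lookup_add lookup_single)
      moreover have "D t' ?t" unfolding t' using jm keys_b by (intro D_koszul) simp_all
      ultimately show ?thesis using D_trans D_sym by blast
    qed
    \<comment> \<open>Equal degrees allow \<open>one\<close> to be applied with the two terms
      interchanged.\<close>
    have n': "total (Suc ?m) (fst s') = ?n"
      using less.prems(3) by (simp add: image_exp_def)
    show ?case
    proof (cases "0 < Poly_Mapping.lookup (fst s) ?m \<or> 0 < Poly_Mapping.lookup (fst s') ?m")
      case True
      then show ?thesis using one D_sym less.prems n' by metis
    next
      case False
      then have z: "?m \<notin> Poly_Mapping.keys (fst s)" "?m \<notin> Poly_Mapping.keys (fst s')"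
        by (auto simp: in_keys_iff)
      have k: "Poly_Mapping.keys (fst s) \<subseteq> {..<?m}" "Poly_Mapping.keys (fst s') \<subseteq> {..<?m}"
        using less.prems(1,2) z by (auto simp: less_Suc_eq)
      have "image_exp (es @ [w]) t = image_exp es t" if "?m \<notin> Poly_Mapping.keys (fst t)" for t
      proof -
        have "weight (es @ [w]) (fst t) = weight es (fst t)"
          using that by (intro poly_mapping_eqI) (simp add: lookup_weight_snoc in_keys_iff)
        then show ?thesis using that by (simp add: image_exp_def total_def in_keys_iff)
      qed
      then have "image_exp es s = image_exp es s'" using less.prems(3) z by metis
      then show ?thesis
        unfolding D_def using binomial_in_rees_ideal[OF k] r by blast
    qed
  qed
  have "p \<in> {p. Const r * p \<in> ?L}"
  proof (rule rees_ideal_binomials[OF p])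
    show "0 \<in> {p. Const r * p \<in> ?L}" using L by (simp add: ideal_of_mpol_ring_def)
  next
    fix x y assume "x \<in> {p. Const r * p \<in> ?L}" "y \<in> {p. Const r * p \<in> ?L}"
    then show "x + y \<in> {p. Const r * p \<in> ?L}"
      using ideal_of_mpol_ring_add[OF L] by (simp add: distrib_left)
  next
    fix s s' :: "(nat \<Rightarrow>\<^sub>0 nat) \<times> ('n \<Rightarrow>\<^sub>0 nat)" and c :: 'k
    assume "Poly_Mapping.keys (fst s) \<subseteq> {..<length (es @ [w])}" "Poly_Mapping.keys (fst s') \<subseteq> {..<length (es @ [w])}"
      "image_exp (es @ [w]) s = image_exp (es @ [w]) s'"
    then show "mterm s c - mterm s' c \<in> {p. Const r * p \<in> ?L}"
      using D[of s s'] by (simp add: D_def)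
  qed
  then show ?thesis by simp
qed

subsection \<open>A uniform power\<close>

text \<open>By the Koszul relations, the substitutions y_i -> u y_i (\<open>g\<close>) and y_i ->
  f_i z (\<open>g'\<close>) agree modulo L'. On a term of degree d the first multiplies by u^d, and
  the second yields the image under the Rees map with t replaced by z.\<close>

lemma power_times_mterm:
  fixes es :: "('n \<Rightarrow>\<^sub>0 nat) list"
  assumes keys: "Poly_Mapping.keys (fst s) \<subseteq> {..<length es}"
  shows "Const (xmon w ^ total (length es) (fst s)) * mterm s (c :: 'k::comm_ring_1) -
      Const (Poly_Mapping.single (fst (image_exp es s)) c) * Var (length es) ^ snd (image_exp es s)
    \<in> linear_rees_ideal (map xmon (es @ [w]))"
proof -
  let ?m = "length es" and ?b = "fst s"
  interpret K: coeff_hom "Const :: ('n, 'k) mpol \<Rightarrow> (nat, ('n, 'k) mpol) mpol" by (rule coeff_hom_Const)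
  have L: "ideal_of_mpol_ring (Suc ?m) (linear_rees_ideal (map xmon (es @ [w])) :: (nat, ('n, 'k) mpol) mpol set)"
    using ideal_of_mpol_ring_linear[of "map xmon (es @ [w])"] by simp
  define g where "g i = Const (xmon w :: ('n, 'k) mpol) * Var i" for i :: nat
  define g' where "g' i = Const (map xmon es ! i :: ('n, 'k) mpol) * Var ?m" for i :: nat
  have tot: "total ?m ?b = (\<Sum>v\<in>Poly_Mapping.keys ?b. Poly_Mapping.lookup ?b v)"
    unfolding total_def using keys by (intro sum.mono_neutral_right) (auto simp: in_keys_iff)
  have "mpol_eval Const g (mterm s c) - mpol_eval Const g' (mterm s c)
      \<in> linear_rees_ideal (map xmon (es @ [w]))"
  proof (rule eval_congruent[OF L mterm_in_mpol_ring[OF keys]])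
    fix i assume i: "i < ?m"
    show "g i \<in> mpol_ring (Suc ?m)" "g' i \<in> mpol_ring (Suc ?m)"
      unfolding g_def g'_def using i by (intro mpol_ring_mult mpol_ring_Const mpol_ring_Var; simp)+
    show "g i - g' i \<in> linear_rees_ideal (map xmon (es @ [w]))"
      unfolding g_def g'_def using koszul_relation[of i "map xmon es" "xmon w"] i by simp
  qed
  moreover have "mpol_eval Const g (mterm s c) = Const (xmon w ^ total ?m ?b) * mterm s c"
  proof -
    have "(\<Prod>v\<in>Poly_Mapping.keys ?b. g v ^ Poly_Mapping.lookup ?b v) =
        Const (xmon w) ^ total ?m ?b * Poly_Mapping.single ?b 1"
      unfolding g_def power_mult_distrib prod.distrib monom_Var tot by (simp only: power_sum)
    then show ?thesis
      unfolding mterm_def K.eval_single K.hpow[symmetric] by (simp add: mult_single mult.commute)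
  qed
  moreover have "mpol_eval Const g' (mterm s c) =
      Const (Poly_Mapping.single (fst (image_exp es s)) c) * Var ?m ^ snd (image_exp es s)"
  proof -
    have "(\<Prod>v\<in>Poly_Mapping.keys ?b. (map xmon es ! v :: ('n, 'k) mpol) ^ Poly_Mapping.lookup ?b v) =
        (\<Prod>v<?m. map xmon es ! v ^ Poly_Mapping.lookup ?b v)"
      using keys by (intro monom_eval_superset) simp_all
    also have "\<dots> = (\<Prod>v<?m. xmon (Poly_Mapping.map ((*) (Poly_Mapping.lookup ?b v)) (es ! v)))"
      by (intro prod.cong) (simp_all add: xmon_power)
    also have "(\<Prod>v<n. xmon (e v) :: ('n, 'k) mpol) = xmon (\<Sum>v<n. e v)" for e and n :: nat
      by (induction n) (simp_all add: mult_single add.commute)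
    finally have "(\<Prod>v\<in>Poly_Mapping.keys ?b. (map xmon es ! v :: ('n, 'k) mpol) ^ Poly_Mapping.lookup ?b v) =
        xmon (weight es ?b)" by (simp add: weight_def)
    then have "(\<Prod>v\<in>Poly_Mapping.keys ?b. g' v ^ Poly_Mapping.lookup ?b v) =
        Const (xmon (weight es ?b)) * Var ?m ^ total ?m ?b"
      unfolding g'_def power_mult_distrib prod.distrib tot
      by (simp only: power_sum[symmetric] K.hpow[symmetric] K.hprod[symmetric])
    then show ?thesis
      unfolding mterm_def K.eval_single image_exp_def
      by (simp add: mult_single mult.assoc[symmetric])
  qed
  ultimately show ?thesis by simp
qed

text \<open>Such pairs index the binomials of J; adding pairs multiplies the first terms and the
  second terms separately.\<close>

definition compatible ::
  "('n \<Rightarrow>\<^sub>0 nat) list \<Rightarrow> ((nat \<Rightarrow>\<^sub>0 nat) \<times> ('n \<Rightarrow>\<^sub>0 nat)) \<times> ((nat \<Rightarrow>\<^sub>0 nat) \<times> ('n \<Rightarrow>\<^sub>0 nat)) \<Rightarrow> bool" where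
  "compatible es p \<longleftrightarrow>
     Poly_Mapping.keys (fst (fst p)) \<subseteq> {..<length es} \<and> Poly_Mapping.keys (fst (snd p)) \<subseteq> {..<length es} \<and>
     image_exp es (fst p) = image_exp es (snd p)"

text \<open>Two terms with the same image have the same degree d, so after multiplication by u^d
  both are congruent to the same multiple of z^d. The factor u^(k-d) is left over.\<close>

lemma power_times_binomial:
  assumes "compatible es p" "total (length es) (fst (fst p)) \<le> k"
  shows "Const (xmon w ^ k) * (mterm (fst p) c - mterm (snd p) c) \<in> linear_rees_ideal (map xmon (es @ [w]))"
proof -
  let ?L = "linear_rees_ideal (map xmon (es @ [w]))"
  let ?d = "total (length es) (fst (fst p))"
  have L: "ideal_of_mpol_ring (Suc (length es)) ?L"
    using ideal_of_mpol_ring_linear[of "map xmon (es @ [w])"] by simp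
  have keys: "Poly_Mapping.keys (fst (fst p)) \<subseteq> {..<length es}" "Poly_Mapping.keys (fst (snd p)) \<subseteq> {..<length es}"
    and im: "image_exp es (snd p) = image_exp es (fst p)"
    using assms by (simp_all add: compatible_def)
  have d: "total (length es) (fst (snd p)) = ?d" using im by (simp add: image_exp_def)
  have "Const (xmon w ^ ?d) * mterm (fst p) c - Const (xmon w ^ ?d) * mterm (snd p) c \<in> ?L"
    using ideal_of_mpol_ring_diff[OF L power_times_mterm[OF keys(1), of w c] power_times_mterm[OF keys(2), of w c]]
    by (simp add: im d)
  then have "Const (xmon w ^ (k - ?d)) * (Const (xmon w ^ ?d) * mterm (fst p) c - Const (xmon w ^ ?d) * mterm (snd p) c) \<in> ?L"
    by (rule ideal_of_mpol_ring_mult[OF L mpol_ring_Const])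
  also have "Const (xmon w ^ (k - ?d)) * (Const (xmon w ^ ?d) * mterm (fst p) c - Const (xmon w ^ ?d) * mterm (snd p) c) =
      Const (xmon w ^ (k - ?d) * xmon w ^ ?d) * (mterm (fst p) c - mterm (snd p) c)"
    by (simp only: right_diff_distrib coeff_hom.hmult[OF coeff_hom_Const] mult.assoc)
  also have "xmon w ^ (k - ?d) * xmon w ^ ?d = (xmon w :: ('a, 'b) mpol) ^ k"
    using assms(2) by (simp flip: power_add)
  finally show ?thesis .
qed

text \<open>The exponents of y and of x are joined in one function on a sum type, the form in which
  \<open>dickson\<close> takes them.\<close>

definition coords :: "(nat \<Rightarrow>\<^sub>0 nat) \<times> ('n \<Rightarrow>\<^sub>0 nat) \<Rightarrow> nat + 'n \<Rightarrow> nat" where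
  "coords s = case_sum (Poly_Mapping.lookup (fst s)) (Poly_Mapping.lookup (snd s))"

lemma coords_add: "coords (s + t) i = coords s i + coords t i"
  by (simp add: coords_def lookup_add split: sum.split)

lemma coords_dvd:
  assumes "Poly_Mapping.keys (fst s) \<subseteq> {..<m}" "\<forall>i\<in>{..<m} <+> UNIV. coords s i \<le> coords t i"
  shows "\<exists>t'. t = s + t'"
proof -
  have "Poly_Mapping.lookup (fst s) j \<le> Poly_Mapping.lookup (fst t) j" for j
  proof (cases "j < m")
    case True
    then show ?thesis using bspec[OF assms(2) InlI[of j "{..<m}"]] by (simp add: coords_def)
  next
    case False
    then have "j \<notin> Poly_Mapping.keys (fst s)" using assms(1) by auto
    then show ?thesis by (simp add: in_keys_iff)
  qed
  then obtain b where "fst t = fst s + b" using exponent_dvd_iff by metis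
  moreover have "Poly_Mapping.lookup (snd s) v \<le> Poly_Mapping.lookup (snd t) v" for v
    using bspec[OF assms(2) InrI[of v UNIV]] by (simp add: coords_def)
  then obtain a where "snd t = snd s + a" using exponent_dvd_iff by metis
  ultimately have "t = s + (b, a)" by (simp add: prod_eq_iff)
  then show ?thesis ..
qed

lemma compatible_cancel: "compatible es p \<Longrightarrow> compatible es (p + q) \<Longrightarrow> compatible es q"
  by (auto simp: compatible_def image_exp_add keys_add_nat)

text \<open>
  The compatible pairs form a monoid closed under subtraction, so by Dickson's lemma it is finitely
  generated. Splitting off generators one by one, a telescoping sum expresses every binomial of the
  Rees ideal through finitely many of them.
\<close>

lemma uniform_power:
  fixes es :: "('n::finite \<Rightarrow>\<^sub>0 nat) list"
  shows "\<exists>k. \<forall>p. \<forall>c :: 'k::comm_ring_1. compatible es p \<longrightarrow>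
    Const (xmon w ^ k) * (mterm (fst p) c - mterm (snd p) c) \<in> linear_rees_ideal (map xmon (es @ [w]))"
proof -
  let ?m = "length es"
  let ?X = "{..<?m} <+> (UNIV :: 'n set)"
  let ?L = "linear_rees_ideal (map xmon (es @ [w])) :: (nat, ('n, 'k) mpol) mpol set"
  have L: "ideal_of_mpol_ring (Suc ?m) ?L"
    using ideal_of_mpol_ring_linear[of "map xmon (es @ [w])"] by simp
  define f where "f p = case_sum (coords (fst p)) (coords (snd p))"
    for p :: "((nat \<Rightarrow>\<^sub>0 nat) \<times> ('n \<Rightarrow>\<^sub>0 nat)) \<times> ((nat \<Rightarrow>\<^sub>0 nat) \<times> ('n \<Rightarrow>\<^sub>0 nat))"
  have f_add: "f (p + q) i = f p i + f q i" for p q i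
    by (simp add: f_def coords_add split: sum.split)
  have split: "\<exists>q. p = h + q" if h: "compatible es h" "\<forall>i\<in>?X <+> ?X. f h i \<le> f p i" for h p
  proof -
    have "\<forall>i\<in>?X. coords (fst h) i \<le> coords (fst p) i"
    proof
      fix i assume "i \<in> ?X"
      from bspec[OF h(2) InlI[OF this]] show "coords (fst h) i \<le> coords (fst p) i" by (simp add: f_def)
    qed

    then obtain q1 where "fst p = fst h + q1" using coords_dvd[of "fst h" ?m "fst p"] h(1)
      unfolding compatible_def by blast
    moreover have "\<forall>i\<in>?X. coords (snd h) i \<le> coords (snd p) i"
    proof
      fix i assume "i \<in> ?X"
      from bspec[OF h(2) InrI[OF this]] show "coords (snd h) i \<le> coords (snd p) i" by (simp add: f_def)
    qed

    then obtain q2 where "snd p = snd h + q2" using coords_dvd[of "snd h" ?m "snd p"] h(1)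
      unfolding compatible_def by blast
    ultimately have "p = h + (q1, q2)" by (simp add: prod_eq_iff)
    then show ?thesis ..
  qed
  \<comment> \<open>The pair 0 has to be excluded: it lies below every pair, so on its own it would
    already satisfy the claim of \<open>dickson\<close>.\<close>
  obtain H where H: "finite H" "H \<subseteq> {p. compatible es p \<and> p \<noteq> 0}"
    "\<forall>p\<in>{p. compatible es p \<and> p \<noteq> 0}. \<exists>h\<in>H. \<forall>i\<in>?X <+> ?X. f h i \<le> f p i"
    using dickson[of "?X <+> ?X" "{p. compatible es p \<and> p \<noteq> 0}" f] by auto
  define k where "k = (\<Sum>h\<in>H. total ?m (fst (fst h)))"
  have k: "total ?m (fst (fst h)) \<le> k" if "h \<in> H" for h
    unfolding k_def using that H(1) by (intro member_le_sum) auto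
  have "Const (xmon w ^ k) * (mterm (fst p) c - mterm (snd p) c) \<in> ?L" if "compatible es p" for p c
    using that
  proof (induction "\<Sum>i\<in>?X <+> ?X. f p i" arbitrary: p rule: less_induct)
    case less
    show ?case
    proof (cases "p = 0")
      case True
      then show ?thesis using L by (simp add: ideal_of_mpol_ring_def)
    next
      case False
      then obtain h where h: "h \<in> H" "\<forall>i\<in>?X <+> ?X. f h i \<le> f p i" using H(3) less.prems by blast
      then have hc: "compatible es h" "h \<noteq> 0" using H(2) by auto
      obtain q where q: "p = h + q" using split[OF hc(1) h(2)] by blast
      have qc: "compatible es q" using compatible_cancel hc(1) less.prems q by blast
      \<comment> \<open>A generator with all coordinates 0 would divide the pair 0 and hence be 0;
        so splitting off \<open>h\<close> strictly lowers the sum of the coordinates.\<close>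
      have "\<exists>i\<in>?X <+> ?X. f h i \<noteq> 0"
      proof (rule ccontr)
        assume "\<not> ?thesis"
        then have "\<forall>i\<in>?X <+> ?X. f h i \<le> f 0 i" by simp
        then obtain g where "0 = h + g" using split[OF hc(1)] by blast
        then have "fst (fst h) + fst (fst g) = 0" "snd (fst h) + snd (fst g) = 0"
          "fst (snd h) + fst (snd g) = 0" "snd (snd h) + snd (snd g) = 0"
          by (simp_all add: prod_eq_iff)
        then have "h = 0"
          by (simp add: prod_eq_iff poly_mapping_eq_iff fun_eq_iff plus_poly_mapping.rep_eq)
        with hc(2) show False ..
      qed
      then have "(\<Sum>i\<in>?X <+> ?X. f q i) < (\<Sum>i\<in>?X <+> ?X. f p i)"
        unfolding q f_add by (intro sum_strict_mono_ex1) auto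
      then have IH: "Const (xmon w ^ k) * (mterm (fst q) c - mterm (snd q) c) \<in> ?L"
        using less.hyps qc by blast
      \<comment> \<open>With h = (h1, h2) and q = (q1, q2) written multiplicatively, h1 q1 - h2 q2 =
        q1 (h1 - h2) + h2 (q1 - q2).\<close>
      have "Const (xmon w ^ k) * (mterm (fst p) c - mterm (snd p) c) =
          mterm (fst q) c * (Const (xmon w ^ k) * (mterm (fst h) 1 - mterm (snd h) 1)) +
          mterm (snd h) 1 * (Const (xmon w ^ k) * (mterm (fst q) c - mterm (snd q) c))"
        using mterm_add[of "fst h" "fst q" 1 c] mterm_add[of "snd h" "snd q" 1 c]
        by (simp add: q algebra_simps)
      also have "\<dots> \<in> ?L"
      proof (rule ideal_of_mpol_ring_add[OF L]; rule ideal_of_mpol_ring_mult[OF L mterm_in_mpol_ring])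
        show "Poly_Mapping.keys (fst (fst q)) \<subseteq> {..<Suc ?m}" "Poly_Mapping.keys (fst (snd h)) \<subseteq> {..<Suc ?m}"
          using qc hc(1) by (auto simp: compatible_def less_Suc_eq)
        show "Const (xmon w ^ k) * (mterm (fst h) 1 - mterm (snd h) 1) \<in> ?L"
          by (rule power_times_binomial[OF hc(1) k[OF h(1)]])
      qed (rule IH)
      finally show ?thesis .
    qed
  qed
  then show ?thesis by blast
qed

subsection \<open>Removing the multiples of a monomial\<close>

text \<open>Sending the terms with a variable of index at least \<open>m\<close> to 0 is the
  substitution z = 0 when \<open>m\<close> counts the f_i. As \<open>D\<close> will only be
  additive, this is in general not a ring homomorphism.\<close>

definition coeff_op :: "nat \<Rightarrow> ('r \<Rightarrow> 'r) \<Rightarrow> (nat, 'r::comm_ring_1) mpol \<Rightarrow> (nat, 'r) mpol" where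
  "coeff_op m D p = Poly_Mapping.mapp (\<lambda>b c. if Poly_Mapping.keys b \<subseteq> {..<m} then D c else 0) p"

lemma lookup_coeff_op:
  assumes "additive D"
  shows "Poly_Mapping.lookup (coeff_op m D p) b =
    (if Poly_Mapping.keys b \<subseteq> {..<m} then D (Poly_Mapping.lookup p b) else 0)"
  using additive.zero[OF assms] by (simp add: coeff_op_def lookup_mapp when_def in_keys_iff)

lemma additive_coeff_op:
  assumes "additive D"
  shows "additive (coeff_op m D)"
  by standard (rule poly_mapping_eqI, simp add: lookup_coeff_op[OF assms] lookup_add additive.add[OF assms])

lemma coeff_op_single:
  assumes "additive D"
  shows "coeff_op m D (Poly_Mapping.single b c) =
    (if Poly_Mapping.keys b \<subseteq> {..<m} then Poly_Mapping.single b (D c) else 0)"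
  using additive.zero[OF assms]
  by (intro poly_mapping_eqI) (auto simp: lookup_coeff_op[OF assms] lookup_single when_def)

lemma additive_mult_right: "additive (\<lambda>x. c * x)" for c :: "'r::comm_ring_1"
  by standard (simp add: distrib_left)

lemma additive_compose: "additive f \<Longrightarrow> additive g \<Longrightarrow> additive (\<lambda>x. f (g x))"
  by standard (simp add: additive.add)

lemma additive_const_zero: "additive (\<lambda>_. 0)"
  by standard simp

lemma additive_expand:
  fixes F :: "('v, 'r::comm_ring_1) mpol \<Rightarrow> 'b::ab_group_add"
  assumes "additive F"
  shows "F q = (\<Sum>d\<in>Poly_Mapping.keys q. F (Poly_Mapping.single d (Poly_Mapping.lookup q d)))"
proof -
  have "F q = F (\<Sum>d\<in>Poly_Mapping.keys q. Poly_Mapping.single d (Poly_Mapping.lookup q d))"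
    by (rule arg_cong[OF mpol_expand, where f = F])
  also have "\<dots> = (\<Sum>d\<in>Poly_Mapping.keys q. F (Poly_Mapping.single d (Poly_Mapping.lookup q d)))"
    by (rule additive.sum[OF assms])
  finally show ?thesis .
qed

lemma additive_eqI:
  fixes F G :: "('v, 'r::comm_ring_1) mpol \<Rightarrow> 'b::ab_group_add"
  assumes "additive F" "additive G"
    and "\<And>d c. F (Poly_Mapping.single d c) = G (Poly_Mapping.single d c)"
  shows "F q = G q"
  unfolding additive_expand[OF assms(1), of q] additive_expand[OF assms(2), of q] assms(3) ..

text \<open>\<open>D\<close> is not assumed to commute with \<open>c\<close>, so the coefficient is
  absorbed into the new operator x -> D(c x).\<close>

lemma coeff_op_single_mult:
  assumes D: "additive D"
  shows "coeff_op m D (Poly_Mapping.single b c * q) =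
    (if Poly_Mapping.keys b \<subseteq> {..<m} then Poly_Mapping.single b 1 * coeff_op m (\<lambda>x. D (c * x)) q else 0)"
proof (cases "Poly_Mapping.keys b \<subseteq> {..<m}")
  case True
  have D': "additive (\<lambda>x. D (c * x))" by (intro additive_compose[OF D] additive_mult_right)
  have "coeff_op m D (Poly_Mapping.single b c * q) = Poly_Mapping.single b 1 * coeff_op m (\<lambda>x. D (c * x)) q"
    by (rule additive_eqI[where q = q])
      (auto intro!: additive_compose[OF additive_coeff_op[OF D]] additive_compose[OF additive_mult_right]
        additive_mult_right additive_coeff_op D'
        simp: mult_single coeff_op_single[OF D] coeff_op_single[OF D'] keys_add_nat True)
  with True show ?thesis by simp
next
  case False
  have "coeff_op m D (Poly_Mapping.single b c * q) = (\<lambda>_. 0) q"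
    by (rule additive_eqI[where q = q])
      (use False in \<open>auto intro!: additive_compose[OF additive_coeff_op[OF D]] additive_mult_right additive_const_zero
        simp: mult_single coeff_op_single[OF D] keys_add_nat\<close>)
  with False show ?thesis by simp
qed

text \<open>A generator of L' is a relation in which the a_i f_i and b u sum to 0. Since
  \<open>D\<close> commutes with the f_i and kills the multiples of u, applying it leaves a relation
  among the f_i with coefficients D(a_i).\<close>

lemma coeff_op_linear_rees_ideal:
  fixes fs :: "'r::comm_ring_1 list"
  assumes p: "p \<in> linear_rees_ideal (fs @ [u])"
    and D: "additive D" "\<And>f x. f \<in> set fs \<Longrightarrow> D (f * x) = f * D x" "\<And>x. D (u * x) = 0"
  shows "coeff_op (length fs) D p \<in> linear_rees_ideal fs"
proof -
  let ?m = "length fs" and ?n = "length (fs @ [u])"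
  note L = ideal_of_mpol_ring_linear[of fs]
  \<comment> \<open>Proving membership for all such operators at once makes \<open>A\<close> closed under multiplication by
    coefficients \<open>c\<close>, as \<open>\<lambda>x. D (c * x)\<close> is again such an operator.\<close>
  define ok where "ok D \<longleftrightarrow> additive D \<and> (\<forall>f\<in>set fs. \<forall>x. D (f * x) = f * D x) \<and> (\<forall>x. D (u * x) = 0)"
    for D :: "'r \<Rightarrow> 'r"
  define A where "A = {p \<in> mpol_ring ?n. \<forall>D. ok D \<longrightarrow> coeff_op ?m D p \<in> linear_rees_ideal fs}"
  have ok_mult: "ok (\<lambda>x. D (c * x))" if "ok D" for D c
    using that unfolding ok_def
    by (auto intro!: additive_compose[of D] additive_mult_right simp: mult.left_commute[of c])
  have "ideal_of_mpol_ring ?n A"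
    unfolding ideal_of_mpol_ring_def
  proof (intro conjI ballI)
    show "A \<subseteq> mpol_ring ?n" by (auto simp: A_def)
    show "0 \<in> A"
      using L by (auto simp: A_def mpol_ring_0 ok_def ideal_of_mpol_ring_def additive.zero[OF additive_coeff_op])
  next
    fix p q :: "(nat, 'r) mpol" assume "p \<in> A" "q \<in> A"
    then show "p + q \<in> A"
      using ideal_of_mpol_ring_add[OF L]
      by (auto simp: A_def mpol_ring_add ok_def additive.add[OF additive_coeff_op])
  next
    fix p q :: "(nat, 'r) mpol" assume p: "p \<in> mpol_ring ?n" and q: "q \<in> A"
    have "coeff_op ?m D (p * q) \<in> linear_rees_ideal fs" if D: "ok D" for D
    proof -
      have add: "additive D" using D by (simp add: ok_def)
      have "additive (\<lambda>p. coeff_op ?m D (q * p))"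
        by (rule additive_compose[OF additive_coeff_op[OF add] additive_mult_right])
      then have "coeff_op ?m D (p * q) =
          (\<Sum>b\<in>Poly_Mapping.keys p. coeff_op ?m D (Poly_Mapping.single b (Poly_Mapping.lookup p b) * q))"
        using additive_expand[of "\<lambda>p. coeff_op ?m D (q * p)" p] by (simp only: mult.commute)
      also have "\<dots> \<in> linear_rees_ideal fs"
      proof (rule ideal_of_mpol_ring_sum[OF L])
        fix b assume "b \<in> Poly_Mapping.keys p"
        have "coeff_op ?m (\<lambda>x. D (Poly_Mapping.lookup p b * x)) q \<in> linear_rees_ideal fs"
          using q ok_mult[OF D] by (auto simp: A_def)
        then show "coeff_op ?m D (Poly_Mapping.single b (Poly_Mapping.lookup p b) * q) \<in> linear_rees_ideal fs"
          using L unfolding coeff_op_single_mult[OF add]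
          by (auto simp: ideal_of_mpol_ring_def mpol_ring_def)
      qed
      finally show ?thesis .
    qed
    moreover have "q \<in> mpol_ring ?n" using q by (simp add: A_def)
    ultimately show "p * q \<in> A" using p by (simp add: A_def mpol_ring_mult)
  qed
  moreover have "linear_relations (fs @ [u]) \<subseteq> A"
  proof
    fix p assume p: "p \<in> linear_relations (fs @ [u])"
    then obtain a where a: "p = (\<Sum>i<?n. Const (a i) * Var i)" "(\<Sum>i<?n. a i * (fs @ [u]) ! i) = 0"
      unfolding linear_relations_def by blast
    have "coeff_op ?m D p \<in> linear_rees_ideal fs" if D: "ok D" for D
    proof -
      have add: "additive D" using D by (simp add: ok_def)
      have "coeff_op ?m D p = (\<Sum>i<?n. coeff_op ?m D (Const (a i) * Var i))"
        unfolding a(1) by (rule additive.sum[OF additive_coeff_op[OF add]])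
      also have "\<dots> = (\<Sum>i<?m. Const (D (a i)) * Var i)"
        by (simp add: mult_single coeff_op_single[OF add])
      also have "\<dots> \<in> linear_rees_ideal fs"
      proof (rule linear_relation_in)
        have "D (a i) * fs ! i = D (a i * fs ! i)" if "i < ?m" for i
          using D nth_mem[OF that] by (metis mult.commute ok_def)
        then have "(\<Sum>i<?m. D (a i) * fs ! i) = (\<Sum>i<?m. D (a i * fs ! i))"
          by simp
        \<comment> \<open>The added summand is 0; it completes the sum to the image under
          \<open>D\<close> of the whole relation.\<close>
        also have "\<dots> = (\<Sum>i<?m. D (a i * fs ! i)) + D (u * a ?m)"
          using D by (simp add: ok_def)
        also have "\<dots> = D (\<Sum>i<?n. a i * (fs @ [u]) ! i)"
          by (simp add: additive.sum[OF add] additive.add[OF add] nth_append mult.commute)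
        finally show "(\<Sum>i<?m. D (a i) * fs ! i) = 0"
          unfolding a(2) additive.zero[OF add] .
      qed
      finally show ?thesis .
    qed
    then show "p \<in> A" using p linear_relations_subset[of "fs @ [u]"] by (auto simp: A_def)
  qed
  ultimately have "linear_rees_ideal (fs @ [u]) \<subseteq> A"
    unfolding linear_rees_ideal_def[of "fs @ [u]"] by (intro hull_minimal)
  then show ?thesis using p D by (auto simp: A_def ok_def)
qed

text \<open>This is the projection onto the span of the monomials not divisible by u =
  \<open>xmon w\<close>; its kernel is the ideal generated by u.\<close>

definition drop_multiples :: "('v \<Rightarrow>\<^sub>0 nat) \<Rightarrow> ('v, 'r::comm_ring_1) mpol \<Rightarrow> ('v, 'r) mpol" where
  "drop_multiples w p = Poly_Mapping.mapp (\<lambda>a c. if \<exists>b. a = w + b then 0 else c) p"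

lemma lookup_drop_multiples:
  "Poly_Mapping.lookup (drop_multiples w p) a = (if \<exists>b. a = w + b then 0 else Poly_Mapping.lookup p a)"
  by (simp add: drop_multiples_def lookup_mapp when_def in_keys_iff)

lemma additive_drop_multiples: "additive (drop_multiples w)"
  by standard (rule poly_mapping_eqI, simp add: lookup_drop_multiples lookup_add)

lemma drop_multiples_single:
  "drop_multiples w (Poly_Mapping.single a c) = (if \<exists>b. a = w + b then 0 else Poly_Mapping.single a c)"
  by (rule poly_mapping_eqI) (auto simp: lookup_drop_multiples lookup_single when_def)

text \<open>If x^e shares no variable with x^w, then x^w divides x^e x^a exactly when it divides
  x^a; thus the same terms are removed before and after the multiplication.\<close>

lemma drop_multiples_mult_coprime:
  assumes "Poly_Mapping.keys e \<inter> Poly_Mapping.keys w = {}"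
  shows "drop_multiples w (xmon e * p) = xmon e * drop_multiples w p"
proof (rule additive_eqI[where q = p])
  have "(\<exists>b. e + a = w + b) \<longleftrightarrow> (\<exists>b. a = w + b)" for a
  proof -
    have "Poly_Mapping.lookup e v = 0 \<or> Poly_Mapping.lookup w v = 0" for v
      using assms by (meson disjoint_iff in_keys_iff)
    then have "Poly_Mapping.lookup w v \<le> Poly_Mapping.lookup (e + a) v \<longleftrightarrow>
        Poly_Mapping.lookup w v \<le> Poly_Mapping.lookup a v" for v
      by (metis add_0 le0 lookup_add)
    then show ?thesis by (simp add: exponent_dvd_iff)
  qed
  then show "drop_multiples w (xmon e * Poly_Mapping.single d c) =
      xmon e * drop_multiples w (Poly_Mapping.single d c)" for d c
    by (simp add: mult_single drop_multiples_single)
qed (auto intro: additive_compose additive_drop_multiples additive_mult_right)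

lemma drop_multiples_multiple: "drop_multiples w (xmon w * p) = 0"
proof -
  have "drop_multiples w (xmon w * p) = (\<lambda>_. 0) p"
    by (rule additive_eqI[where q = p])
      (auto intro!: additive_compose[OF additive_drop_multiples] additive_mult_right additive_const_zero
        simp: mult_single drop_multiples_single)
  then show ?thesis by simp
qed

lemma diff_drop_multiples: "r - drop_multiples w r \<in> ideal.span {xmon w}"
proof -
  have add: "additive (\<lambda>r. r - drop_multiples w r)"
    by standard (simp add: additive.add[OF additive_drop_multiples])
  have "r - drop_multiples w r = (\<Sum>a\<in>Poly_Mapping.keys r. Poly_Mapping.single a (Poly_Mapping.lookup r a) -
      drop_multiples w (Poly_Mapping.single a (Poly_Mapping.lookup r a)))"
    by (rule additive_expand[OF add])
  also have "\<dots> \<in> ideal.span {xmon w}"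
  proof (rule ideal.span_sum)
    fix a
    show "Poly_Mapping.single a (Poly_Mapping.lookup r a) -
      drop_multiples w (Poly_Mapping.single a (Poly_Mapping.lookup r a)) \<in> ideal.span {xmon w}"
    proof (cases "\<exists>b. a = w + b")
      case True
      then obtain b where b: "a = w + b" ..
      have "Poly_Mapping.single b (Poly_Mapping.lookup r a) * xmon w \<in> ideal.span {xmon w}"
        by (intro ideal.span_scale ideal.span_base) simp
      with True show ?thesis by (simp add: drop_multiples_single mult_single b add.commute)
    qed (simp add: drop_multiples_single ideal.span_zero)
  qed
  finally show ?thesis .
qed

text \<open>The part \<open>e\<close> is given by its values, so that one and the same
  \<open>e\<close> can be split off from two exponents that agree on \<open>X\<close>.\<close>

lemma split_off_common_part:
  fixes a :: "'v \<Rightarrow>\<^sub>0 nat"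
  assumes "\<And>v. Poly_Mapping.lookup e v = (if v \<in> X then Poly_Mapping.lookup a v else 0)"
  obtains a0 where "a = e + a0" "Poly_Mapping.keys a0 \<inter> X = {}"
proof
  show "a = e + (a - e)" using assms by (intro poly_mapping_eqI) (simp add: lookup_add lookup_minus)
  show "Poly_Mapping.keys (a - e) \<inter> X = {}" using assms by (auto simp: in_keys_iff lookup_minus)
qed

lemma restrict_exponent:
  fixes a :: "'v \<Rightarrow>\<^sub>0 nat"
  obtains e where "\<And>v. Poly_Mapping.lookup e v = (if v \<in> X then Poly_Mapping.lookup a v else 0)"
proof
  show "Poly_Mapping.lookup (Poly_Mapping.mapp (\<lambda>v k. if v \<in> X then k else 0) a) v =
    (if v \<in> X then Poly_Mapping.lookup a v else 0)" for v
    by (simp add: lookup_mapp when_def in_keys_iff)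
qed

text \<open>The coefficients of two terms with the same image agree in the variables of u, as the
  f_i do not involve them. That part x^e is thus a common factor, and it remains to treat binomials
  with coefficients coprime to u, for which the operator turns the factor \<open>r\<close> into
  \<open>drop_multiples w r\<close>.\<close>

lemma drop_multiples_conductor:
  fixes es :: "('n \<Rightarrow>\<^sub>0 nat) list" and r :: "('n, 'k::comm_ring_1) mpol"
  assumes coprime: "\<forall>e\<in>set es. Poly_Mapping.keys e \<inter> Poly_Mapping.keys w = {}"
    and r: "r \<in> conductor_gens (map xmon (es @ [w]))"
  shows "drop_multiples w r \<in> conductor_gens (map xmon es)"
proof -
  let ?m = "length es" and ?D = "drop_multiples w :: ('n, 'k) mpol \<Rightarrow> _"
  let ?L = "linear_rees_ideal (map xmon es) :: (nat, ('n, 'k) mpol) mpol set"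
  have L: "ideal_of_mpol_ring ?m ?L"
    using ideal_of_mpol_ring_linear[of "map xmon es"] by simp
  have "p \<in> {p. Const (?D r) * p \<in> ?L}" if p: "p \<in> rees_ideal (map xmon es)" for p
  proof (rule rees_ideal_binomials[OF p])
    show "0 \<in> {p. Const (?D r) * p \<in> ?L}" using L by (simp add: ideal_of_mpol_ring_def)
  next
    fix x y assume "x \<in> {p. Const (?D r) * p \<in> ?L}" "y \<in> {p. Const (?D r) * p \<in> ?L}"
    then show "x + y \<in> {p. Const (?D r) * p \<in> ?L}"
      using ideal_of_mpol_ring_add[OF L] by (simp add: distrib_left)
  next
    fix s s' :: "(nat \<Rightarrow>\<^sub>0 nat) \<times> ('n \<Rightarrow>\<^sub>0 nat)" and c :: 'k
    assume keys: "Poly_Mapping.keys (fst s) \<subseteq> {..<?m}" "Poly_Mapping.keys (fst s') \<subseteq> {..<?m}"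
      and im: "image_exp es s = image_exp es s'"
    obtain e where e: "\<And>v. Poly_Mapping.lookup e v =
        (if v \<in> Poly_Mapping.keys w then Poly_Mapping.lookup (snd s) v else 0)"
      using restrict_exponent[of "Poly_Mapping.keys w" "snd s"] by blast
    obtain a where a: "snd s = e + a" "Poly_Mapping.keys a \<inter> Poly_Mapping.keys w = {}"
      using split_off_common_part[OF e] .
    have "Poly_Mapping.lookup (snd s) v = Poly_Mapping.lookup (snd s') v" if "v \<in> Poly_Mapping.keys w" for v
    proof -
      have "Poly_Mapping.lookup (snd s + weight es (fst s)) v = Poly_Mapping.lookup (snd s' + weight es (fst s')) v"
        using im by (simp add: image_exp_def)
      then show ?thesis using lookup_weight_coprime[OF coprime that] by (simp add: lookup_add)
    qed
    then have e': "Poly_Mapping.lookup e v =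
        (if v \<in> Poly_Mapping.keys w then Poly_Mapping.lookup (snd s') v else 0)" for v
      using e by simp
    obtain a' where a': "snd s' = e + a'" "Poly_Mapping.keys a' \<inter> Poly_Mapping.keys w = {}"
      using split_off_common_part[OF e'] .
    define t t' where "t = (fst s, a)" and "t' = (fst s', a')"
    have st: "s = (0, e) + t" "s' = (0, e) + t'" by (simp_all add: t_def t'_def prod_eq_iff a a')
    have "mterm t c - mterm t' c \<in> rees_ideal (map xmon es)"
    proof (rule binomial_in_rees_ideal)
      show "image_exp es t = image_exp es t'"
        using im unfolding st image_exp_add by (simp only: add_left_cancel)
    qed (use keys in \<open>simp_all add: t_def t'_def\<close>)
    then have "mterm t c - mterm t' c \<in> rees_ideal (map xmon es @ [xmon w])"
      using rees_ideal_append_subset by blast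
    then have "Const r * (mterm t c - mterm t' c) \<in> linear_rees_ideal (map xmon es @ [xmon w])"
      using r by (simp add: conductor_gens_def)
    then have "coeff_op (length (map xmon es :: ('n, 'k) mpol list)) ?D (Const r * (mterm t c - mterm t' c)) \<in> ?L"
    proof (rule coeff_op_linear_rees_ideal)
      show "?D (f * x) = f * ?D x" if "f \<in> set (map xmon es)" for f x
        using that coprime by (auto simp: drop_multiples_mult_coprime)
    qed (simp_all add: additive_drop_multiples drop_multiples_multiple)
    moreover have "coeff_op ?m ?D (Const r * (mterm t c - mterm t' c)) = Const (?D r) * (mterm t c - mterm t' c)"
    proof -
      have D: "?D (r * Poly_Mapping.single d c) = ?D r * Poly_Mapping.single d c"
        if "Poly_Mapping.keys d \<inter> Poly_Mapping.keys w = {}" for d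
      proof -
        \<comment> \<open>The operator commutes with x^d by coprimality and with the constant
          \<open>c\<close> because it acts term by term.\<close>
        have "Poly_Mapping.single d c = xmon d * Const c" by (simp add: mult_single)
        moreover have "?D (r * Const c) = ?D r * Const c"
          by (rule poly_mapping_eqI)
            (simp add: lookup_drop_multiples mult.commute[of _ "Const c"] mult_map_scale_conv_mult[symmetric]
              Poly_Mapping.map.rep_eq when_def)
        ultimately show ?thesis
          using drop_multiples_mult_coprime[OF that, of "r * Const c"] by (simp add: mult_ac)
      qed
      show ?thesis
        using keys D[OF a(2)] D[OF a'(2)]
        by (simp add: right_diff_distrib additive.diff[OF additive_coeff_op[OF additive_drop_multiples]]
            mterm_def t_def t'_def mult_single coeff_op_single[OF additive_drop_multiples])
    qed
    \<comment> \<open>Multiplying by the common factor x^e returns to the original binomial.\<close>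
    ultimately have "mterm (0, e) 1 * (Const (?D r) * (mterm t c - mterm t' c)) \<in> ?L"
      by (intro ideal_of_mpol_ring_mult[OF L mterm_in_mpol_ring]) simp_all
    then show "mterm s c - mterm s' c \<in> {p. Const (?D r) * p \<in> ?L}"
      using mterm_add[of "(0, e)" t 1 c] mterm_add[of "(0, e)" t' 1 c]
      by (simp add: st algebra_simps)
  qed
  then show ?thesis by (auto simp: conductor_gens_def)
qed

section \<open>From explicit generators to the theorem\<close>

lemma subspace_conductor_gens: "ideal.subspace (conductor_gens fs)"
proof (rule ideal.subspaceI)
  note L = ideal_of_mpol_ring_linear[of fs]
  show "0 \<in> conductor_gens fs" using L by (simp add: conductor_gens_def ideal_of_mpol_ring_def)
  show "x + y \<in> conductor_gens fs" if "x \<in> conductor_gens fs" "y \<in> conductor_gens fs" for x y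
    using that ideal_of_mpol_ring_add[OF L] by (simp add: conductor_gens_def single_add distrib_right)
  show "c * x \<in> conductor_gens fs" if "x \<in> conductor_gens fs" for c x
    using that ideal_of_mpol_ring_mult[OF L mpol_ring_Const]
    by (simp add: conductor_gens_def coeff_hom.hmult[OF coeff_hom_Const] mult.assoc)
qed

lemma conductor_gens_append_monomial:
  fixes es :: "('n::finite \<Rightarrow>\<^sub>0 nat) list" and w :: "'n \<Rightarrow>\<^sub>0 nat"
  defines "C \<equiv> conductor_gens (map xmon es :: ('n, 'k::comm_ring_1) mpol list)"
    and "C' \<equiv> conductor_gens (map xmon (es @ [w]) :: ('n, 'k) mpol list)"
  assumes coprime: "\<forall>e\<in>set es. Poly_Mapping.keys e \<inter> Poly_Mapping.keys w = {}"
  shows "C' \<subseteq> ideal.span (insert (xmon w) C)"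
    and "\<exists>k>0. ideal.span (insert (xmon w ^ k) C) \<subseteq> C'"
proof -
  show "C' \<subseteq> ideal.span (insert (xmon w) C)"
  proof
    fix r assume "r \<in> C'"
    then have "drop_multiples w r \<in> C"
      unfolding C_def C'_def by (rule drop_multiples_conductor[OF coprime])
    then have "drop_multiples w r \<in> ideal.span (insert (xmon w) C)" by (intro ideal.span_base) simp
    moreover have "r - drop_multiples w r \<in> ideal.span (insert (xmon w) C)"
      using diff_drop_multiples ideal.span_mono[of "{xmon w}" "insert (xmon w) C"] by blast
    ultimately have "drop_multiples w r + (r - drop_multiples w r) \<in> ideal.span (insert (xmon w) C)"
      by (rule ideal.span_add)
    then show "r \<in> ideal.span (insert (xmon w) C)" by simp
  qed
next
  let ?L = "linear_rees_ideal (map xmon (es @ [w])) :: (nat, ('n, 'k) mpol) mpol set"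
  have L: "ideal_of_mpol_ring (Suc (length es)) ?L"
    using ideal_of_mpol_ring_linear[of "map xmon (es @ [w])"] by simp
  have sub: "ideal.subspace C'" unfolding C'_def by (rule subspace_conductor_gens)
  \<comment> \<open>Here r J \<subseteq> L \<subseteq> L', and by
    \<open>rees_multiplier_extends\<close> this gives r J' \<subseteq> L'.\<close>
  have "C \<subseteq> C'"
  proof
    fix r assume "r \<in> C"
    then have "Const r * p \<in> ?L" if "p \<in> rees_ideal (map xmon es)" for p
      using that linear_rees_ideal_append_subset[of "map xmon es" "[xmon w]"]
      by (auto simp: C_def conductor_gens_def)
    then show "r \<in> C'"
      unfolding C'_def conductor_gens_def using rees_multiplier_extends[OF coprime] by blast
  qed
  obtain k where k: "\<And>p (c :: 'k). compatible es p \<Longrightarrow>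
      Const (xmon w ^ k) * (mterm (fst p) c - mterm (snd p) c) \<in> ?L"
    using uniform_power[of es w, where 'k = 'k] by blast
  have "p \<in> {p. Const (xmon w ^ k) * p \<in> ?L}" if p: "p \<in> rees_ideal (map xmon es)" for p
  proof (rule rees_ideal_binomials[OF p])
    show "0 \<in> {p. Const (xmon w ^ k) * p \<in> ?L}" using L by (simp add: ideal_of_mpol_ring_def)
  next
    fix x y assume "x \<in> {p. Const (xmon w ^ k) * p \<in> ?L}" "y \<in> {p. Const (xmon w ^ k) * p \<in> ?L}"
    then show "x + y \<in> {p. Const (xmon w ^ k) * p \<in> ?L}"
      using ideal_of_mpol_ring_add[OF L] by (simp add: distrib_left)
  next
    fix s s' :: "(nat \<Rightarrow>\<^sub>0 nat) \<times> ('n \<Rightarrow>\<^sub>0 nat)" and c :: 'k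
    assume "Poly_Mapping.keys (fst s) \<subseteq> {..<length es}" "Poly_Mapping.keys (fst s') \<subseteq> {..<length es}"
      "image_exp es s = image_exp es s'"
    then show "mterm s c - mterm s' c \<in> {p. Const (xmon w ^ k) * p \<in> ?L}"
      using k[of "(s, s')" c] by (simp add: compatible_def)
  qed
  then have "xmon w ^ k \<in> C'"
    unfolding C'_def conductor_gens_def using rees_multiplier_extends[OF coprime] by blast
  \<comment> \<open>The exponent is raised by one, since \<open>k\<close> may be 0 while a positive
    exponent is required.\<close>
  then have "xmon w ^ Suc k \<in> C'" using ideal.subspace_scale[OF sub] by simp
  with \<open>C \<subseteq> C'\<close> have "ideal.span (insert (xmon w ^ Suc k) C) \<subseteq> C'"
    by (intro ideal.span_minimal sub) simp
  then show "\<exists>k>0. ideal.span (insert (xmon w ^ k) C) \<subseteq> C'" by blast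
qed

text \<open>Since u is a non-zerodivisor modulo I, powers of u cancel. Hence a monomial of I stays
  in I when its part in the variables of u is removed, so the monomials of I coprime to u generate
  I; Dickson's lemma picks finitely many of them.\<close>

lemma coprime_monomial_generators:
  fixes I :: "('n::finite, 'k::comm_ring_1) mpol set"
  assumes I: "monomial_ideal I" and nzd: "nonzerodivisor_mod I (xmon w)"
  obtains es where "I = ideal.span (set (map xmon es))"
    "\<forall>e\<in>set es. Poly_Mapping.keys e \<inter> Poly_Mapping.keys w = {}"
proof -
  obtain M where M: "\<And>p. p \<in> M \<Longrightarrow> is_monomial p" "I = ideal.span M"
    using I by (auto simp: monomial_ideal_def)
  define S where "S = {a. xmon a \<in> I \<and> Poly_Mapping.keys a \<inter> Poly_Mapping.keys w = {}}"
  obtain H where H: "finite H" "H \<subseteq> S" "\<forall>s\<in>S. \<exists>h\<in>H. \<forall>v\<in>UNIV. Poly_Mapping.lookup h v \<le> Poly_Mapping.lookup s v"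
    using dickson[of UNIV S Poly_Mapping.lookup] by auto
  obtain es where es: "set es = H" using finite_list[OF H(1)] by blast
  have pow: "p \<in> I" if "xmon w ^ n * p \<in> I" for n p
    using that
  proof (induction n)
    case (Suc n)
    have "xmon w * (xmon w ^ n * p) \<in> I" using Suc.prems by (simp add: mult.assoc)
    then have "xmon w ^ n * p \<in> I" using nzd unfolding nonzerodivisor_mod_def by blast
    then show ?case by (rule Suc.IH)
  qed simp
  have "ideal.span (set (map xmon es)) = I"
  proof
    show "ideal.span (set (map xmon es)) \<subseteq> I"
      using H(2) es M(2) by (intro ideal.span_minimal) (auto simp: S_def)
    have "M \<subseteq> ideal.span (set (map xmon es))"
    proof
      fix p assume p: "p \<in> M"
      then obtain a where a: "p = xmon a" using M(1) by (auto simp: is_monomial_def)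
      have aI: "xmon a \<in> I" using p a M(2) ideal.span_base by auto
      obtain e where e: "\<And>v. Poly_Mapping.lookup e v =
          (if v \<in> Poly_Mapping.keys w then Poly_Mapping.lookup a v else 0)"
        using restrict_exponent[of "Poly_Mapping.keys w" a] by blast
      obtain b where b: "a = e + b" "Poly_Mapping.keys b \<inter> Poly_Mapping.keys w = {}"
        using split_off_common_part[OF e] .
      \<comment> \<open>This is a crude bound for all exponents of \<open>a\<close>. The variables
        of u have exponent at least 1 in u, so x^e divides u^N, and u^N x^b becomes a multiple of
        x^a.\<close>
      define N where "N = (\<Sum>v\<in>UNIV. Poly_Mapping.lookup a v)"
      have "Poly_Mapping.lookup e v \<le> Poly_Mapping.lookup (Poly_Mapping.map ((*) N) w) v" for v
      proof -
        have "Poly_Mapping.lookup a v \<le> N" unfolding N_def by (rule member_le_sum) auto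
        then show ?thesis unfolding e lookup_map_mult by (cases "Poly_Mapping.lookup w v") (auto simp: in_keys_iff)
      qed
      then obtain d where d: "Poly_Mapping.map ((*) N) w = e + d" using exponent_dvd_iff by metis
      have "xmon w ^ N * xmon b = xmon d * (xmon a :: ('n, 'k) mpol)"
        by (simp add: xmon_power d b mult_single ac_simps)
      moreover have "xmon d * xmon a \<in> I" using aI M(2) ideal.span_scale by auto
      ultimately have "xmon b \<in> I" using pow by metis
      then have "b \<in> S" using b(2) by (simp add: S_def)
      then obtain h where h: "h \<in> H" "\<forall>v. Poly_Mapping.lookup h v \<le> Poly_Mapping.lookup b v"
        using H(3) by blast
      then obtain g where g: "b = h + g" using exponent_dvd_iff[of b h] by blast
      have "xmon (e + g) * xmon h \<in> ideal.span (set (map xmon es))"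
        using h(1) es by (intro ideal.span_scale ideal.span_base) auto
      then show "p \<in> ideal.span (set (map xmon es))"
        by (simp add: a b(1) g mult_single ac_simps)
    qed
    then show "I \<subseteq> ideal.span (set (map xmon es))"
      unfolding M(2) by (intro ideal.span_minimal) simp_all
  qed
  moreover have "\<forall>e\<in>set es. Poly_Mapping.keys e \<inter> Poly_Mapping.keys w = {}"
    using H(2) unfolding es S_def by blast
  ultimately show thesis using that by metis
qed

theorem theorem2p1:
  fixes I :: "('n::finite, 'k::field) mpol set" and u :: "('n, 'k) mpol"
  assumes "monomial_ideal I"
    and "is_monomial u"
    and "nonzerodivisor_mod I u"
  shows "conductor (ideal.span (insert u I)) \<subseteq> ideal.span (insert u (conductor I)) \<and>
    (\<exists>k>0. ideal.span (insert (u ^ k) (conductor I)) \<subseteq> conductor (ideal.span (insert u I)))"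
proof -
  obtain w where w: "u = xmon w" using assms(2) by (auto simp: is_monomial_def)
  obtain es where es: "I = ideal.span (set (map xmon es))"
    "\<forall>e\<in>set es. Poly_Mapping.keys e \<inter> Poly_Mapping.keys w = {}"
    using coprime_monomial_generators[OF assms(1) assms(3)[unfolded w]] .
  \<comment> \<open>The monomial u goes last, so that its variable is the z of the lemmas on
    \<open>es @ [w]\<close>.\<close>
  let ?fs = "map xmon (es @ [w]) :: ('n, 'k) mpol list"
  have "ideal.span (set ?fs) = ideal.span (insert u I)"
  proof
    have "set (map xmon es) \<subseteq> I" unfolding es(1) by (rule ideal.span_superset)
    then have "set ?fs \<subseteq> insert u I" by (auto simp: w)
    then show "ideal.span (set ?fs) \<subseteq> ideal.span (insert u I)" by (rule ideal.span_mono)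
    have "I \<subseteq> ideal.span (set ?fs)" unfolding es(1) by (rule ideal.span_mono) auto
    moreover have "u \<in> ideal.span (set ?fs)" unfolding w by (rule ideal.span_base) simp
    ultimately show "ideal.span (insert u I) \<subseteq> ideal.span (set ?fs)"
      by (intro ideal.span_minimal ideal.subspace_span) simp
  qed
  then have 1: "conductor (ideal.span (insert u I)) = conductor_gens ?fs"
    by (rule conductor_eq)
  have 2: "conductor I = conductor_gens (map xmon es)"
    using es(1)[symmetric] by (rule conductor_eq)
  show ?thesis
    unfolding 1 2 unfolding w by (intro conjI conductor_gens_append_monomial es(2))
qed

end
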